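(* Let the field $D$, the levels $\gamma_-(\cdot),\gamma_\star(\cdot),\gamma_+(\cdot)$, the set $Z_{\rm reg}$, the desired vicinity $V_\star(t)$, the initial location $\boldsymbol r_{\rm in}$ and the speed bound $\bar v>0$ satisfy the assumptions (A1)–(A4) listed in the context. Then there exist controller parameters $\nu>0$, $\mu>0$, $d_\ast\in\mathbb{R}$ such that the following claim holds: (i) The closed-loop trajectory starting at $\boldsymbol r(0)=\boldsymbol r_{\rm in}$ reaches $V_\star(t)$ in a finite time $t_0$ and stays there afterwards: $\boldsymbol r(t)\in V_\star(t)$ for all $t\ge t_0$. Moreover, for any bounded and closed domain $E\subset\mathbb{R}^2$ lying in the interior of the set $\{\boldsymbol r:(0,\boldsymbol r)\in Z_{\rm reg}\}$, there exist common parameters $\nu,\mu,d_\ast$ for which (i) holds whenever $\boldsymbol r_{\rm in}\in E$.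
   Context: **Closed-loop system.** A point robot $\boldsymbol r(t)\in\mathbb{R}^2$ in a time-varying scalar field $D(t,\boldsymbol r)$, $t\ge0$, moves according to $\dot{\boldsymbol r}=\bar v\,\vec e\{\mu[d(t)-\nu t-d_\ast]\}$, $\boldsymbol r(0)=\boldsymbol r_{\rm in}$, where $d(t):=D[t,\boldsymbol r(t)]$, $\vec e(\theta):=(\cos\theta,\sin\theta)^\top$. **Field characteristics.** $\nabla$ and $D''$ denote the spatial gradient and the spatial Hessian, subscripts $t$ denote time derivatives, $\langle\cdot;\cdot\rangle$ is the inner product. At points where $\nabla D\ne0$, $N:=\nabla D/\|\nabla D\|$, and $T$ is the unit vector obtained by rotating $N$ clockwise by $\pi/2$ (so $(T,N)$ is right-handed). The characteristics of the spatial isolines are given by: $\rho=\|\nabla D\|$ (density of isolines), $\lambda=-D'_t/\|\nabla D\|$ (front velocity), $v_\rho=\langle\nabla D'_t+\lambda D''N;N\rangle/\|\nabla D\|$ (relative growth rate of $\rho$ over time), $\omega=-\langle\nabla D'_t+\lambda D''N;T\rangle/\|\nabla D\|$ (angular velocity of the isoline), $\alpha=-\frac{D''_{tt}+\lambda\langle\nabla D'_t;N\rangle}{\|\nabla D\|}-\lambda v_\rho$ (front acceleration), $\varkappa=-\langle D''T;T\rangle/\|\nabla D\|$ (signed curvature), $\omega_\nabla=-\langle\nabla D'_t;T\rangle/\|\nabla D\|$ (angular velocity of the gradient), $\tau_\rho=\langle D''N;T\rangle/\|\nabla D\|$, $n_\rho=\langle D''N;N\rangle/\|\nabla D\|$ (relative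 growth rates of $\rho$ under tangential and normal displacement). **Assumptions.** (A1) $D$ is $C^2$-smooth, and there exist continuous functions $\boldsymbol r^0(t)\in\mathbb{R}^2$ and $\gamma_{\inf}(t)<D[t,\boldsymbol r^0(t)]$ such that $\nabla D(t,\boldsymbol r)\ne0$ for all $\boldsymbol r\ne\boldsymbol r^0(t)$ and $D(t,\boldsymbol r)\to\gamma_{\inf}(t)$ as $\|\boldsymbol r\|\to\infty$. (Hence $\boldsymbol r^0(t)$ is the maximizer of $D(t,\cdot)$.) (A2) $V_\star(t)$ is the desired $R_\star$-neighborhood of $\boldsymbol r^0(t)$ ($R_\star>0$ given). The functions $\gamma_-,\gamma_\star,\gamma_+$ of $t\ge0$ are smooth, $\gamma_{\inf}(t)<\gamma_-(t)<\gamma_\star(t)<\gamma_+(t)<D[t,\boldsymbol r^0(t)]$ for all $t$, $\gamma_-(0)<D[0,\boldsymbol r_{\rm in}]$, and $D(t,\boldsymbol r)\ge\gamma_\star(t)\Rightarrow\boldsymbol r\in V_\star(t)$. Put $Z_{\rm reg}:=\{(t,\boldsymbol r):t\ge0,\ \gamma_-(t)\le D(t,\boldsymbol r)\le\gamma_+(t)\}$. (A3) There exist constants $b_\rho,b_\lambda,b_\omega,b_\omega^\nabla,b_\varkappa,b_v,b_\alpha,b_\tau,b_n$ and $\gamma_+^0,\bar\gamma$ such that $|\rho|\le b_\rho$, $|\lambda|\le b_\lambda$, $|\omega|\le b_\omega$, $|\omega_\nabla|\le b_\omega^\nabla$, $|\varkappa|\le b_\varkappa$, $|v_\rho|\le b_v$,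 $|\alpha|\le b_\alpha$, $|\tau_\rho|\le b_\tau$, $|n_\rho|\le b_n$ everywhere in $Z_{\rm reg}$, and $\gamma_+(t)\le\gamma_+^0$, $|\dot\gamma_i(t)|\le\bar\gamma$ for all $t\ge 0$ and $i=-,+,\star$. (A4) There exists $\varepsilon>0$ such that $\rho\ge\varepsilon$ and $\bar v\ge|\lambda|+\rho^{-1}\bar\gamma+\varepsilon$ everywhere in $Z_{\rm reg}$, and $\gamma_-(t)+\varepsilon\le\gamma_\star(t)\le\gamma_+(t)-\varepsilon$ for all $t\ge0$. *)

theory Defs
  imports "HOL-Analysis.Analysis"
begin

text \<open>
  Time ranges over the closed half-line. All time derivatives are taken within \<open>{0..}\<close>, hence
  are one-sided at \<open>t = 0\<close>. The smoothness predicates below are meant for sets \<open>S\<close>, such as the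
  closed half-line and the closed half-space, at whose points derivatives within \<open>S\<close> are unique.
\<close>

definition C1_on :: "('a::real_normed_vector \<Rightarrow> 'b::real_normed_vector) \<Rightarrow> 'a set \<Rightarrow> bool" where
  "C1_on f S \<longleftrightarrow>
    (\<exists>f' :: 'a \<Rightarrow> 'a \<Rightarrow>\<^sub>L 'b.
      (\<forall>x\<in>S. (f has_derivative blinfun_apply (f' x)) (at x within S)) \<and> continuous_on S f')"

definition C2_on :: "('a::real_normed_vector \<Rightarrow> 'b::real_normed_vector) \<Rightarrow> 'a set \<Rightarrow> bool" where
  "C2_on f S \<longleftrightarrow>
    (\<exists>f' :: 'a \<Rightarrow> 'a \<Rightarrow>\<^sub>L 'b.
      (\<forall>x\<in>S. (f has_derivative blinfun_apply (f' x)) (at x within S)) \<and> C1_on f' S)"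

definition grad :: "(real^2 \<Rightarrow> real) \<Rightarrow> real^2 \<Rightarrow> real^2" where
  "grad f r = (THE g. GDERIV f r :> g)"

definition hess :: "(real^2 \<Rightarrow> real) \<Rightarrow> real^2 \<Rightarrow> real^2 \<Rightarrow> real^2" where
  "hess f r = frechet_derivative (grad f) (at r)"

definition time_deriv :: "(real \<Rightarrow> real) \<Rightarrow> real \<Rightarrow> real" where
  "time_deriv g t = vector_derivative g (at t within {0..})"

type_synonym field2 = "real \<Rightarrow> real^2 \<Rightarrow> real"

definition D_t :: "field2 \<Rightarrow> field2" where
  "D_t D t r = time_deriv (\<lambda>s. D s r) t"

definition D_tt :: "field2 \<Rightarrow> field2" where
  "D_tt D = D_t (D_t D)"

definition rot_cw :: "real^2 \<Rightarrow> real^2" where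
  "rot_cw x = vector [x $ 2, - (x $ 1)]"

definition N_vec :: "field2 \<Rightarrow> real \<Rightarrow> real^2 \<Rightarrow> real^2" where
  "N_vec D t r = grad (D t) r /\<^sub>R norm (grad (D t) r)"

definition T_vec :: "field2 \<Rightarrow> real \<Rightarrow> real^2 \<Rightarrow> real^2" where
  "T_vec D t r = rot_cw (N_vec D t r)"

text \<open>
  The characteristics of the spatial isolines; they are meaningful only where the spatial gradient
  does not vanish.
\<close>

definition iso_rho :: "field2 \<Rightarrow> field2" where
  "iso_rho D t r = norm (grad (D t) r)"

definition iso_lambda :: "field2 \<Rightarrow> field2" where
  "iso_lambda D t r = - D_t D t r / norm (grad (D t) r)"

definition iso_v_rho :: "field2 \<Rightarrow> field2" where
  "iso_v_rho D t r =
    ((grad (D_t D t) r + iso_lambda D t r *\<^sub>R hess (D t) r (N_vec D t r)) \<bullet> N_vec D t r)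
      / norm (grad (D t) r)"

definition iso_omega :: "field2 \<Rightarrow> field2" where
  "iso_omega D t r =
    - (((grad (D_t D t) r + iso_lambda D t r *\<^sub>R hess (D t) r (N_vec D t r)) \<bullet> T_vec D t r)
      / norm (grad (D t) r))"

definition iso_alpha :: "field2 \<Rightarrow> field2" where
  "iso_alpha D t r =
    - ((D_tt D t r + iso_lambda D t r * (grad (D_t D t) r \<bullet> N_vec D t r))
      / norm (grad (D t) r))
    - iso_lambda D t r * iso_v_rho D t r"

definition iso_kappa :: "field2 \<Rightarrow> field2" where
  "iso_kappa D t r =
    - ((hess (D t) r (T_vec D t r) \<bullet> T_vec D t r) / norm (grad (D t) r))"

definition iso_omega_grad :: "field2 \<Rightarrow> field2" where
  "iso_omega_grad D t r =
    - ((grad (D_t D t) r \<bullet> T_vec D t r) / norm (grad (D t) r))"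

definition iso_tau_rho :: "field2 \<Rightarrow> field2" where
  "iso_tau_rho D t r =
    (hess (D t) r (N_vec D t r) \<bullet> T_vec D t r) / norm (grad (D t) r)"

definition iso_n_rho :: "field2 \<Rightarrow> field2" where
  "iso_n_rho D t r =
    (hess (D t) r (N_vec D t r) \<bullet> N_vec D t r) / norm (grad (D t) r)"

definition Z_reg :: "field2 \<Rightarrow> (real \<Rightarrow> real) \<Rightarrow> (real \<Rightarrow> real) \<Rightarrow> (real \<times> (real^2)) set" where
  "Z_reg D \<gamma>m \<gamma>p = {(t, r). t \<ge> 0 \<and> \<gamma>m t \<le> D t r \<and> D t r \<le> \<gamma>p t}"

definition e_vec :: "real \<Rightarrow> real^2" where
  "e_vec \<theta> = vector [cos \<theta>, sin \<theta>]"

definition closed_loop ::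
  "field2 \<Rightarrow> real \<Rightarrow> real \<Rightarrow> real \<Rightarrow> real \<Rightarrow> real^2 \<Rightarrow> (real \<Rightarrow> real^2) \<Rightarrow> bool" where
  "closed_loop D v \<nu> \<mu> ds r_in r \<longleftrightarrow>
    r 0 = r_in \<and>
    (\<forall>t\<ge>0. (r has_vector_derivative v *\<^sub>R e_vec (\<mu> * (D t (r t) - \<nu> * t - ds)))
              (at t within {0..}))"

text \<open>
  The closed-loop trajectory is a function on \<open>{0..}\<close>, but its rendering as a total function is not
  unique. So existence of a trajectory is asserted, and the property is required of every one.
\<close>

definition reaches_and_stays ::
  "field2 \<Rightarrow> real \<Rightarrow> (real \<Rightarrow> (real^2) set) \<Rightarrow> real \<Rightarrow> real \<Rightarrow> real \<Rightarrow> real^2 \<Rightarrow> bool" where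
  "reaches_and_stays D v V \<nu> \<mu> ds r_in \<longleftrightarrow>
    (\<exists>r. closed_loop D v \<nu> \<mu> ds r_in r) \<and>
    (\<forall>r. closed_loop D v \<nu> \<mu> ds r_in r \<longrightarrow> (\<exists>t0\<ge>0. \<forall>t\<ge>t0. r t \<in> V t))"

end

theory Submission
  imports Defs
begin

text \<open>
  Take the ramp slope \<open>\<nu> = \<gamma>bar + \<epsilon>\<^sup>2 / 2\<close>. In the regular zone, heading along the gradient makes the
  field value grow at rate at least \<open>\<gamma>bar + \<epsilon>\<^sup>2\<close>, whereas the gradient direction turns at a rate
  bounded independently of \<open>\<mu>\<close>. So for large \<open>\<mu>\<close> the angle from the gradient to the heading never
  crosses a multiple of \<open>2 * pi\<close> downwards and loses at most one turn. As the heading is \<open>\<mu>\<close> times the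
  excess of the field value over the ramp, during any stay in the regular zone the field value
  gains at least \<open>(\<gamma>bar + \<epsilon>\<^sup>2 / 4) * (elapsed time)\<close> minus \<open>2 * pi / \<mu>\<close>. Relative to each of the levels,
  which move no faster than \<open>\<gamma>bar\<close>, it thus loses at most \<open>2 * pi / \<mu>\<close> and increases in the long run:
  the robot cannot fall below \<open>\<gamma>m\<close>, must reach \<open>\<gamma>p\<close>, and afterwards never falls back to \<open>\<gamma>s\<close>.
\<close>

section \<open>Global solutions, barriers and polar lifts\<close>

lemma integral_has_vector_derivative_half_line:
  fixes g :: "real \<Rightarrow> 'a::banach"
  assumes "continuous_on {0..} g" "t \<ge> 0"
  shows "((\<lambda>u. integral {0..u} g) has_vector_derivative g t) (at t within {0..})"
proof -
  have "((\<lambda>u. integral {0..u} g) has_vector_derivative g t) (at t within {0..t+1})"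
    using assms by (intro integral_has_vector_derivative) (auto intro: continuous_on_subset)
  \<comment> \<open>The right end \<open>t+1\<close> lies beyond \<open>t\<close>, so the compact
    interval and the half-line coincide near \<open>t\<close>, also at \<open>t = 0\<close>.\<close>
  moreover have "at t within {0..t+1} = at t within {0..}"
    by (rule at_within_nhd[of _ "{..<t+1}"]) auto
  ultimately show ?thesis by simp
qed

text \<open>A mean value inequality with a majorant \<open>h\<close> in place of a constant bound.
  The Picard estimates below take \<open>h\<close> linear to confine the iterates and exponential to
  compare consecutive ones.\<close>

lemma norm_diff_le_of_derivative_bound:
  fixes f :: "real \<Rightarrow> 'a::real_normed_vector"
  assumes f: "\<And>t. t \<ge> 0 \<Longrightarrow> (f has_vector_derivative f' t) (at t within {0..})"
    and h: "\<And>t. t \<ge> 0 \<Longrightarrow> (h has_real_derivative h' t) (at t within {0..})"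
    and le: "\<And>s. 0 < s \<Longrightarrow> s < t \<Longrightarrow> norm (f' s) \<le> h' s"
    and t: "t \<ge> 0"
  shows "norm (f t - f 0) \<le> h t - h 0"
proof (cases "t = 0")
  case False
  have nb: "at s within {0..} = at s" if "s > 0" for s :: real
    using that by (intro at_within_interior) (simp add: interior_Ici)
  show ?thesis
  proof (rule differentiable_bound_general)
    show "0 < t" using t False by simp
    show "continuous_on {0..t} f"
      by (rule continuous_on_vector_derivative, rule has_vector_derivative_within_subset[OF f]) auto
    show "continuous_on {0..t} h"
      by (rule continuous_on_vector_derivative, rule has_vector_derivative_within_subset,
          rule h[THEN iffD1[OF has_real_derivative_iff_has_vector_derivative]]) auto
    fix s assume s: "0 < s" "s < t"
    show "(f has_vector_derivative f' s) (at s)" "(h has_vector_derivative h' s) (at s)"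
      using f[of s] h[of s] s nb[of s] by (auto simp: has_real_derivative_iff_has_vector_derivative)
    show "norm (f' s) \<le> h' s" by (rule le[OF s])
  qed
qed simp

text \<open>As \<open>f\<close> is bounded by \<open>B\<close>, every Picard iterate stays within
  \<open>B * T\<close> of \<open>x0\<close> on \<open>{0..T}\<close>, where one Lipschitz constant
  serves. In the weight \<open>exp (2 * L * t)\<close> each iteration halves the bound on the
  distance of consecutive iterates, so they converge on all of \<open>{0..T}\<close> without
  patching short intervals together.\<close>

lemma global_solution_exists:
  fixes f :: "real \<Rightarrow> 'a::banach \<Rightarrow> 'a"
  assumes cont: "continuous_on ({0..} \<times> UNIV) (\<lambda>(t, x). f t x)"
    and bound: "\<And>t x. t \<ge> 0 \<Longrightarrow> norm (f t x) \<le> B"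
    and lip: "\<And>T \<rho>. \<exists>L. \<forall>t\<in>{0..T}. L-lipschitz_on (cball x0 \<rho>) (f t)"
  obtains x where "x 0 = x0"
    "\<And>t. t \<ge> 0 \<Longrightarrow> (x has_vector_derivative f t (x t)) (at t within {0..})"
proof -
  define X where "X = rec_nat (\<lambda>_. x0) (\<lambda>_ Y t. x0 + integral {0..t} (\<lambda>s. f s (Y s)))"
  have X_0: "X 0 = (\<lambda>_. x0)" and
    X_Suc: "X (Suc k) = (\<lambda>t. x0 + integral {0..t} (\<lambda>s. f s (X k s)))" for k
    by (simp_all add: X_def)
  have X_init [simp]: "X k 0 = x0" for k by (cases k) (auto simp: X_0 X_Suc)
  have fcont: "continuous_on {0..} (\<lambda>s. f s (Y s))" if "continuous_on {0..} Y" for Y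
    by (rule continuous_on_compose2[OF cont, of _ "\<lambda>s. (s, Y s)", simplified])
       (auto intro!: continuous_intros that)
  have deriv_step: "((\<lambda>t. x0 + integral {0..t} (\<lambda>s. f s (Y s))) has_vector_derivative f t (Y t))
      (at t within {0..})" if "continuous_on {0..} Y" "t \<ge> 0" for Y t
    using has_vector_derivative_add[OF has_vector_derivative_const
        integral_has_vector_derivative_half_line[OF fcont[OF that(1)] that(2)]] by simp
  have X_cont: "continuous_on {0..} (X k)" for k
  proof (induction k)
    case (Suc k)
    show ?case unfolding X_Suc
      by (rule continuous_on_vector_derivative, rule deriv_step[OF Suc]) auto
  qed (simp add: X_0)
  have X_deriv: "(X (Suc k) has_vector_derivative f t (X k t)) (at t within {0..})" if "t \<ge> 0" for k t
    unfolding X_Suc by (rule deriv_step[OF X_cont that])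
  have B0: "B \<ge> 0" using bound[of 0 undefined] norm_ge_zero order_trans by blast
  have X_bound: "norm (X k t - x0) \<le> B * t" if "t \<ge> 0" for k t
  proof (cases k)
    case (Suc j)
    have "norm (X (Suc j) t - X (Suc j) 0) \<le> B * t - B * 0"
      by (rule norm_diff_le_of_derivative_bound[OF X_deriv, where h'="\<lambda>_. B"])
         (auto intro!: derivative_eq_intros bound simp: that)
    then show ?thesis by (simp add: Suc)
  qed (use that B0 in \<open>simp add: X_0\<close>)
  \<comment> \<open>A series formed pointwise in \<open>t\<close> gives one limit function for every
    \<open>T\<close> at once.\<close>
  define Y where "Y t = x0 + (\<Sum>k. X (Suc k) t - X k t)" for t
  have lim: "uniform_limit {0..T} X Y sequentially"
    and flim: "uniform_limit {0..T} (\<lambda>k s. f s (X k s)) (\<lambda>s. f s (Y s)) sequentially"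
    if T: "T \<ge> 0" for T
  proof -
    obtain L0 where L0: "\<And>t. t \<in> {0..T} \<Longrightarrow> L0-lipschitz_on (cball x0 (B * T)) (f t)"
      using lip[of T "B * T"] by blast
    \<comment> \<open>The maximum with \<open>1\<close> makes the constant positive, so that it can
      be divided by.\<close>
    define L where "L = max L0 1"
    have L: "L-lipschitz_on (cball x0 (B * T)) (f t)" if "t \<in> {0..T}" for t
      using L0[OF that] by (rule lipschitz_on_le) (simp add: L_def)
    have L1: "L > 0" by (simp add: L_def)
    have X_ball: "X k t \<in> cball x0 (B * T)" if "t \<in> {0..T}" for k t
    proof -
      have "norm (X k t - x0) \<le> B * t" using X_bound that by auto
      also have "\<dots> \<le> B * T" using that B0 by (auto intro: mult_left_mono)
      finally show ?thesis by (simp add: dist_norm norm_minus_commute)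
    qed
    define C where "C = B * T"
    have C0: "C \<ge> 0" using B0 T by (simp add: C_def)
    \<comment> \<open>Integration turns \<open>L * exp (2 * L * s)\<close> into at most
      \<open>exp (2 * L * t) / 2\<close>; this is the factor \<open>1/2\<close> gained per
      step.\<close>
    have diff: "norm (X (Suc k) t - X k t) \<le> C * (1/2)^k * exp (2 * L * t)" if "t \<in> {0..T}" for k t
      using that
    proof (induction k arbitrary: t)
      case 0
      have "norm (X (Suc 0) t - X 0 t) \<le> C"
        using X_ball[OF 0, of "Suc 0"] by (simp add: X_0 C_def dist_norm norm_minus_commute)
      also have "\<dots> \<le> C * exp (2 * L * t)"
        using C0 L1 0 by (simp add: mult_le_cancel_left1 not_less)
      finally show ?case by simp
    next
      case (Suc k)
      have "norm ((X (Suc (Suc k)) t - X (Suc k) t) - (X (Suc (Suc k)) 0 - X (Suc k) 0))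
        \<le> C * (1/2)^Suc k * exp (2 * L * t) - C * (1/2)^Suc k * exp (2 * L * 0)"
      proof (rule norm_diff_le_of_derivative_bound[where
            f'="\<lambda>s. f s (X (Suc k) s) - f s (X k s)" and h'="\<lambda>s. L * (C * (1/2)^k * exp (2 * L * s))"])
        fix s assume s: "0 < s" "s < t"
        then have sT: "s \<in> {0..T}" using Suc.prems by auto
        have "norm (f s (X (Suc k) s) - f s (X k s)) \<le> L * norm (X (Suc k) s - X k s)"
          using lipschitz_onD[OF L[OF sT] X_ball[OF sT] X_ball[OF sT]] by (simp add: dist_norm)
        also have "\<dots> \<le> L * (C * (1/2)^k * exp (2 * L * s))"
          using Suc.IH[OF sT] L1 by (intro mult_left_mono) auto
        finally show "norm (f s (X (Suc k) s) - f s (X k s)) \<le> L * (C * (1/2)^k * exp (2 * L * s))" .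
      qed (use Suc.prems in \<open>auto intro!: derivative_eq_intros X_deriv\<close>)
      also have "\<dots> \<le> C * (1/2)^Suc k * exp (2 * L * t)" using C0 by simp
      finally show ?case by simp
    qed
    have "uniform_limit {0..T} (\<lambda>n t. \<Sum>k<n. X (Suc k) t - X k t) (\<lambda>t. \<Sum>k. X (Suc k) t - X k t) sequentially"
    proof (rule Weierstrass_m_test)
      show "norm (X (Suc k) t - X k t) \<le> C * exp (2 * L * T) * (1/2)^k" if "t \<in> {0..T}" for k t
      proof -
        have "C * (1/2)^k * exp (2 * L * t) \<le> C * (1/2)^k * exp (2 * L * T)"
          using that C0 L1 by (intro mult_left_mono) auto
        then show ?thesis using diff[OF that, of k] by (simp add: mult_ac)
      qed
      show "summable (\<lambda>k. C * exp (2 * L * T) * (1/2)^k)"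
        by (intro summable_mult summable_geometric) simp
    qed
    then have "uniform_limit {0..T} (\<lambda>n t. x0 + (\<Sum>k<n. X (Suc k) t - X k t)) Y sequentially"
      unfolding Y_def by (intro uniform_limit_intros)
    moreover have "x0 + (\<Sum>k<n. X (Suc k) t - X k t) = X n t" for n t
      using sum_lessThan_telescope[of "\<lambda>k. X k t" n] by (simp add: X_0)
    ultimately show lim: "uniform_limit {0..T} X Y sequentially" by simp
    have Y_ball: "Y t \<in> cball x0 (B * T)" if "t \<in> {0..T}" for t
      by (rule closed_sequentially[OF closed_cball, of "\<lambda>k. X k t"])
         (use X_ball[OF that] tendsto_uniform_limitI[OF lim that] in auto)
    show "uniform_limit {0..T} (\<lambda>k s. f s (X k s)) (\<lambda>s. f s (Y s)) sequentially"
    proof (rule uniform_limitI)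
      fix e :: real assume e: "e > 0"
      have "\<forall>\<^sub>F k in sequentially. \<forall>t\<in>{0..T}. dist (X k t) (Y t) < e / L"
        using uniform_limitD[OF lim, of "e / L"] e L1 by simp
      then show "\<forall>\<^sub>F k in sequentially. \<forall>s\<in>{0..T}. dist (f s (X k s)) (f s (Y s)) < e"
      proof eventually_elim
        case (elim k)
        show ?case
        proof
          fix s assume s: "s \<in> {0..T}"
          have "dist (f s (X k s)) (f s (Y s)) \<le> L * dist (X k s) (Y s)"
            by (rule lipschitz_onD[OF L[OF s] X_ball[OF s] Y_ball[OF s]])
          also have "\<dots> < e" using elim s L1 by (simp add: field_simps)
          finally show "dist (f s (X k s)) (f s (Y s)) < e" .
        qed
      qed
    qed
  qed
  have Y_cont: "continuous_on {0..} Y"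
    unfolding continuous_on_eq_continuous_within
  proof
    fix t :: real assume t: "t \<in> {0..}"
    have "continuous_on {0..t+1} Y"
      by (rule uniform_limit_theorem[OF _ lim])
         (use t in \<open>auto intro!: always_eventually continuous_on_subset[OF X_cont]\<close>)
    moreover have "at t within {0..t+1} = at t within {0..}"
      using t by (intro at_within_nhd[of _ "{..<t+1}"]) auto
    ultimately show "continuous (at t within {0..}) Y"
      using t by (auto simp: continuous_on_eq_continuous_within dest!: bspec[of _ _ t])
  qed
  \<comment> \<open>The recursion for \<open>X (Suc k)\<close> passes to the limit under the
    integral because \<open>f s (X k s)\<close> converges uniformly in \<open>s\<close>.\<close>
  have Y_int: "Y t = x0 + integral {0..t} (\<lambda>s. f s (Y s))" if t: "t \<ge> 0" for t
  proof -
    obtain I J where IJ: "\<And>k. ((\<lambda>s. f s (X k s)) has_integral I k) {0..t}"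
      "((\<lambda>s. f s (Y s)) has_integral J) {0..t}" "I \<longlonglongrightarrow> J"
      by (rule uniform_limit_integral[OF flim[OF t]])
         (auto intro: continuous_on_subset[OF fcont[OF X_cont]])
    have "(\<lambda>k. x0 + I k) \<longlonglongrightarrow> x0 + J" using IJ(3) by (intro tendsto_intros)
    moreover have "x0 + I k = X (Suc k) t" for k
      using integral_unique[OF IJ(1)[of k]] by (simp add: X_Suc)
    moreover have "(\<lambda>k. X (Suc k) t) \<longlonglongrightarrow> Y t"
      using LIMSEQ_Suc[OF tendsto_uniform_limitI[OF lim[OF t], of t]] t by simp
    ultimately have "Y t = x0 + J" using LIMSEQ_unique by auto
    then show ?thesis using integral_unique[OF IJ(2)] by simp
  qed
  show ?thesis
  proof
    show "Y 0 = x0" using Y_int[of 0] by simp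
    fix t :: real assume t: "t \<ge> 0"
    show "(Y has_vector_derivative f t (Y t)) (at t within {0..})"
      by (rule has_vector_derivative_transform[OF _ _ deriv_step[OF Y_cont t]]) (use t Y_int in auto)
  qed
qed

section \<open>Extremal zeros and a one-sided barrier\<close>

text \<open>The supremum \<open>c\<close> of the closed set where \<open>h\<close> is nonnegative
  works: the intermediate value theorem gives a zero in \<open>{c..b}\<close>, and no point after
  \<open>c\<close> can be one, so \<open>h c = 0\<close>.\<close>

lemma last_zero_before_negative:
  fixes h :: "real \<Rightarrow> real"
  assumes cont: "continuous_on {a..b} h" and ab: "a \<le> b" and ha: "h a \<ge> 0" and hb: "h b < 0"
  obtains c where "a \<le> c" "c < b" "h c = 0" "\<And>s. c < s \<Longrightarrow> s \<le> b \<Longrightarrow> h s < 0"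
proof -
  define A where "A = {a..b} \<inter> h -` {0..}"
  define c where "c = Sup A"
  have "closed A" unfolding A_def by (rule continuous_closed_preimage) (use cont in auto)
  moreover have A: "a \<in> A" "bdd_above A" using ha ab by (auto simp: A_def)
  ultimately have "c \<in> A" unfolding c_def by (intro closed_contains_Sup) auto
  then have c: "a \<le> c" "c < b" "h c \<ge> 0" using hb by (auto simp: A_def less_le)
  have after: "h s < 0" if "c < s" "s \<le> b" for s
    using cSup_upper[OF _ A(2), of s] that c by (force simp: A_def c_def not_le)
  obtain x where "c \<le> x" "x \<le> b" "h x = 0"
    using IVT2'[of h b 0 c] c hb continuous_on_subset[OF cont, of "{c..b}"] by auto
  then have "h c = 0" using after[of x] by (cases "x = c") auto
  then show ?thesis using that c after by blast
qed

text \<open>The preceding lemma after replacing \<open>s\<close> by \<open>a + b - s\<close> and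
  changing the sign of \<open>h\<close>, which exchanges the two ends.\<close>

lemma first_zero_after_positive:
  fixes h :: "real \<Rightarrow> real"
  assumes cont: "continuous_on {a..b} h" and ab: "a \<le> b" and ha: "h a > 0" and hb: "h b \<le> 0"
  obtains c where "a < c" "c \<le> b" "h c = 0" "\<And>s. a \<le> s \<Longrightarrow> s < c \<Longrightarrow> h s > 0"
proof -
  have "continuous_on {a..b} (\<lambda>s. - h (a + b - s))"
    by (intro continuous_intros continuous_on_compose2[OF cont]) auto
  then obtain c where "a \<le> c" "c < b" "- h (a + b - c) = 0"
    and after: "\<And>s. c < s \<Longrightarrow> s \<le> b \<Longrightarrow> - h (a + b - s) < 0"
    by (rule last_zero_before_negative) (use assms in auto)
  moreover have "h s > 0" if "a \<le> s" "s < a + b - c" for s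
    using after[of "a + b - s"] that by simp
  ultimately show ?thesis using that[of "a + b - c"] by simp
qed

text \<open>After the last zero before a negative value \<open>\<psi>\<close> is negative, yet a
  positive derivative at that zero makes it positive just to the right. Only the sign of the
  derivative at zeros enters.\<close>

lemma nonneg_barrier:
  fixes \<psi> :: "real \<Rightarrow> real"
  assumes deriv: "\<And>t. t \<in> {a..b} \<Longrightarrow> (\<psi> has_real_derivative \<psi>' t) (at t within {a..b})"
    and init: "\<psi> a \<ge> 0"
    and barrier: "\<And>t. t \<in> {a..b} \<Longrightarrow> \<psi> t = 0 \<Longrightarrow> \<psi>' t > 0"
    and t: "t \<in> {a..b}"
  shows "\<psi> t \<ge> 0"
proof (rule ccontr)
  assume neg: "\<not> \<psi> t \<ge> 0"
  have "continuous_on {a..t} \<psi>"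
    by (rule continuous_on_subset[OF DERIV_continuous_on[OF deriv]]) (use t in auto)
  then obtain c where c: "a \<le> c" "c < t" "\<psi> c = 0" and after: "\<And>s. c < s \<Longrightarrow> s \<le> t \<Longrightarrow> \<psi> s < 0"
    by (rule last_zero_before_negative) (use init t neg in auto)
  then have cab: "c \<in> {a..b}" using t by auto
  obtain \<delta> where "\<delta> > 0" and inc: "\<And>h. h > 0 \<Longrightarrow> c + h \<in> {a..b} \<Longrightarrow> h < \<delta> \<Longrightarrow> \<psi> c < \<psi> (c + h)"
    using has_real_derivative_pos_inc_right[OF deriv[OF cab] barrier[OF cab c(3)]] by auto
  \<comment> \<open>Halving \<open>\<delta>\<close> keeps the step strictly inside the range of
    increase; \<open>t - c\<close> keeps it where \<open>\<psi>\<close> is negative.\<close>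
  define h where "h = min (\<delta>/2) (t - c)"
  have "\<psi> c < \<psi> (c + h)" using \<open>\<delta> > 0\<close> c t by (intro inc) (auto simp: h_def min_def)
  moreover have "\<psi> (c + h) < 0" using \<open>\<delta> > 0\<close> c by (intro after) (auto simp: h_def)
  ultimately show False using c by simp
qed

text \<open>The integral \<open>L\<close> of \<open>z' / z\<close> is a logarithm of
  \<open>z\<close> up to a constant, since \<open>z t * exp (- L t)\<close> has zero derivative. Its
  imaginary part, shifted by \<open>Arg (z a)\<close>, is a differentiable choice of the
  angle.\<close>

lemma complex_polar_lift:
  fixes z z' :: "real \<Rightarrow> complex"
  assumes deriv: "\<And>t. t \<in> {a..b} \<Longrightarrow> (z has_vector_derivative z' t) (at t within {a..b})"
    and cont: "continuous_on {a..b} z'"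
    and nz: "\<And>t. t \<in> {a..b} \<Longrightarrow> z t \<noteq> 0"
  obtains \<phi> where "\<And>t. t \<in> {a..b} \<Longrightarrow> z t = norm (z t) * cis (\<phi> t)"
    "\<And>t. t \<in> {a..b} \<Longrightarrow> (\<phi> has_real_derivative Im (z' t / z t)) (at t within {a..b})"
proof -
  define L where "L t = integral {a..t} (\<lambda>s. z' s / z s)" for t
  have zcont: "continuous_on {a..b} z"
    by (rule continuous_on_vector_derivative[OF deriv])
  have L: "(L has_vector_derivative z' t / z t) (at t within {a..b})" if "t \<in> {a..b}" for t
    unfolding L_def
    by (rule integral_has_vector_derivative) (use that nz cont zcont in \<open>auto intro!: continuous_intros\<close>)
  have const: "z t * exp (- L t) = z a" if t: "t \<in> {a..b}" for t
  proof -
    have "((\<lambda>t. z t * exp (- L t)) has_vector_derivative 0) (at s within {a..b})"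
      if s: "s \<in> {a..b}" for s
    proof -
      have "((\<lambda>t. exp (- L t)) has_vector_derivative - (z' s / z s) * exp (- L s)) (at s within {a..b})"
        using field_vector_diff_chain_within[OF has_vector_derivative_minus[OF L[OF s]]
            has_field_derivative_at_within[OF DERIV_exp]]
        by (simp add: o_def)
      from has_vector_derivative_mult[OF deriv[OF s] this] show ?thesis
        using nz[OF s] by simp
    qed
    then obtain c where "\<And>t. t \<in> {a..b} \<Longrightarrow> z t * exp (- L t) = c"
      using has_vector_derivative_zero_constant[of "{a..b}"] by auto
    from this[OF t] this[of a] t show ?thesis by (simp add: L_def)
  qed
  define \<phi> where "\<phi> t = Arg (z a) + Im (L t)" for t
  show ?thesis
  proof
    fix t assume t: "t \<in> {a..b}"
    have zt: "z t = z a * exp (L t)" using const[OF t] by (simp add: exp_minus field_simps)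
    have za: "z a = norm (z a) * cis (Arg (z a))" using rcis_cmod_Arg[of "z a"] by (simp add: rcis_def)
    show "z t = norm (z t) * cis (\<phi> t)"
      unfolding zt norm_mult norm_exp_eq_Re \<phi>_def cis_mult[symmetric]
      by (subst za) (simp add: exp_eq_polar)
    show "(\<phi> has_real_derivative Im (z' t / z t)) (at t within {a..b})"
      unfolding \<phi>_def
      using bounded_linear.has_vector_derivative[OF bounded_linear_Im L[OF t]]
      by (auto intro!: derivative_eq_intros simp: has_real_derivative_iff_has_vector_derivative)
  qed
qed

section \<open>Derivatives of the field\<close>

text \<open>The mean value theorem is applied twice: along \<open>u\<close> to the increment in
  direction \<open>w\<close>, then along \<open>w\<close>. Only points of the parallelogram are
  visited, so \<open>S\<close> may have a boundary.\<close>

lemma second_difference_mean_value: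
  fixes F :: "'a::real_normed_vector \<Rightarrow> real"
  assumes F: "\<And>x. x \<in> S \<Longrightarrow> (F has_derivative blinfun_apply (F' x)) (at x within S)"
    and F': "\<And>x. x \<in> S \<Longrightarrow> (F' has_derivative blinfun_apply (F'' x)) (at x within S)"
    and S: "\<And>s t. s \<in> {0..h} \<Longrightarrow> t \<in> {0..h} \<Longrightarrow> x + s *\<^sub>R u + t *\<^sub>R w \<in> S"
    and h: "h > 0"
  obtains s t where "s \<in> {0..h}" "t \<in> {0..h}"
    "F (x + h *\<^sub>R u + h *\<^sub>R w) - F (x + h *\<^sub>R u) - F (x + h *\<^sub>R w) + F x
      = h * h * F'' (x + s *\<^sub>R u + t *\<^sub>R w) w u"
proof -
  have line: "((\<lambda>s. F (x + s *\<^sub>R u + t *\<^sub>R w)) has_derivative (\<lambda>y. F' (x + s *\<^sub>R u + t *\<^sub>R w) (y *\<^sub>R u)))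
      (at s within {0..h})" if "s \<in> {0..h}" "t \<in> {0..h}" for s t
    by (rule has_derivative_in_compose2[OF F, where f="\<lambda>s. x + s *\<^sub>R u + t *\<^sub>R w"])
       (use that S in \<open>auto intro!: derivative_eq_intros\<close>)
  have "\<exists>s\<in>{0<..<h}. (F (x + h *\<^sub>R u + h *\<^sub>R w) - F (x + h *\<^sub>R u + 0 *\<^sub>R w))
      - (F (x + 0 *\<^sub>R u + h *\<^sub>R w) - F (x + 0 *\<^sub>R u + 0 *\<^sub>R w))
    = F' (x + s *\<^sub>R u + h *\<^sub>R w) ((h - 0) *\<^sub>R u) - F' (x + s *\<^sub>R u + 0 *\<^sub>R w) ((h - 0) *\<^sub>R u)"
    by (rule mvt_simple[OF h], rule has_derivative_diff; rule line) (use h in auto)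
  then obtain s where s: "s \<in> {0<..<h}" and s_eq:
    "F (x + h *\<^sub>R u + h *\<^sub>R w) - F (x + h *\<^sub>R u) - F (x + h *\<^sub>R w) + F x
      = h * (F' (x + s *\<^sub>R u + h *\<^sub>R w) u - F' (x + s *\<^sub>R u + 0 *\<^sub>R w) u)"
    by (auto simp: blinfun.scaleR_right algebra_simps)
  have line': "((\<lambda>t. F' (x + s *\<^sub>R u + t *\<^sub>R w) u) has_derivative
      (\<lambda>y. F'' (x + s *\<^sub>R u + t *\<^sub>R w) (y *\<^sub>R w) u)) (at t within {0..h})" if "t \<in> {0..h}" for t
  proof -
    have "((\<lambda>t. F' (x + s *\<^sub>R u + t *\<^sub>R w)) has_derivative
      (\<lambda>y. F'' (x + s *\<^sub>R u + t *\<^sub>R w) (y *\<^sub>R w))) (at t within {0..h})"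
      by (rule has_derivative_in_compose2[OF F', where f="\<lambda>t. x + s *\<^sub>R u + t *\<^sub>R w"])
         (use that s S in \<open>auto intro!: derivative_eq_intros\<close>)
    from bounded_linear.has_derivative[OF blinfun.bounded_linear_left this] show ?thesis .
  qed
  have "\<exists>t\<in>{0<..<h}. F' (x + s *\<^sub>R u + h *\<^sub>R w) u - F' (x + s *\<^sub>R u + 0 *\<^sub>R w) u
      = F'' (x + s *\<^sub>R u + t *\<^sub>R w) ((h - 0) *\<^sub>R w) u"
    by (rule mvt_simple[OF h line']) auto
  then obtain t where "t \<in> {0<..<h}" "F' (x + s *\<^sub>R u + h *\<^sub>R w) u - F' (x + s *\<^sub>R u + 0 *\<^sub>R w) u
      = h * F'' (x + s *\<^sub>R u + t *\<^sub>R w) w u"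
    by (auto simp: blinfun.scaleR_right blinfun.scaleR_left)
  then show ?thesis using s s_eq by (intro that[of s t]) auto
qed

text \<open>The parallelogram condition makes the symmetry available at boundary points of \<open>S\<close>.\<close>

lemma second_derivative_symmetric_within:
  fixes F :: "'a::real_normed_vector \<Rightarrow> real"
  assumes F: "\<And>x. x \<in> S \<Longrightarrow> (F has_derivative blinfun_apply (F' x)) (at x within S)"
    and F': "\<And>x. x \<in> S \<Longrightarrow> (F' has_derivative blinfun_apply (F'' x)) (at x within S)"
    and cont: "continuous_on S F''"
    and S: "\<And>s t. s \<in> {0..1} \<Longrightarrow> t \<in> {0..1} \<Longrightarrow> x + s *\<^sub>R u + t *\<^sub>R w \<in> S"
  shows "F'' x u w = F'' x w u"
proof -
  define h :: "nat \<Rightarrow> real" where "h n = inverse (Suc n)" for n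
  have h: "h n > 0" "h n \<le> 1" for n
    by (auto simp: h_def inverse_le_1_iff)
  have h0: "h \<longlonglongrightarrow> 0" unfolding h_def by (rule LIMSEQ_inverse_real_of_nat)
  \<comment> \<open>The same second difference is computed in both orders, so the two mixed
    derivatives agree at two points of a small parallelogram. As it shrinks to \<open>x\<close>,
    continuity of \<open>F''\<close> merges the points.\<close>
  have "\<exists>s t s' t'. s \<in> {0..h n} \<and> t \<in> {0..h n} \<and> s' \<in> {0..h n} \<and> t' \<in> {0..h n} \<and>
    F'' (x + s *\<^sub>R u + t *\<^sub>R w) w u = F'' (x + s' *\<^sub>R u + t' *\<^sub>R w) u w" for n
  proof -
    have S1: "x + s *\<^sub>R u + t *\<^sub>R w \<in> S" if "s \<in> {0..h n}" "t \<in> {0..h n}" for s t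
      using that h[of n] by (intro S) auto
    have S2: "x + t *\<^sub>R w + s *\<^sub>R u \<in> S" if "t \<in> {0..h n}" "s \<in> {0..h n}" for s t
      using S1[OF that(2,1)] by (simp add: add_ac)
    have swap: "x + a *\<^sub>R w + b *\<^sub>R u = x + b *\<^sub>R u + a *\<^sub>R w" for a b by simp
    obtain s t where 1: "s \<in> {0..h n}" "t \<in> {0..h n}"
      "F (x + h n *\<^sub>R u + h n *\<^sub>R w) - F (x + h n *\<^sub>R u) - F (x + h n *\<^sub>R w) + F x
        = h n * h n * F'' (x + s *\<^sub>R u + t *\<^sub>R w) w u"
      by (rule second_difference_mean_value[OF F F' S1 h(1)])
    obtain t' s' where 2: "t' \<in> {0..h n}" "s' \<in> {0..h n}"
      "F (x + h n *\<^sub>R w + h n *\<^sub>R u) - F (x + h n *\<^sub>R w) - F (x + h n *\<^sub>R u) + F x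
        = h n * h n * F'' (x + t' *\<^sub>R w + s' *\<^sub>R u) u w"
      by (rule second_difference_mean_value[OF F F' S2 h(1)])
    have "h n * h n * F'' (x + s *\<^sub>R u + t *\<^sub>R w) w u = h n * h n * F'' (x + s' *\<^sub>R u + t' *\<^sub>R w) u w"
      using 1(3) 2(3)[unfolded swap] by linarith
    then show ?thesis using 1(1,2) 2(1,2) h(1)[of n] by auto
  qed
  then obtain s t s' t' where st: "\<And>n. s n \<in> {0..h n}" "\<And>n. t n \<in> {0..h n}" "\<And>n. s' n \<in> {0..h n}"
    "\<And>n. t' n \<in> {0..h n}"
    and eq: "\<And>n. F'' (x + s n *\<^sub>R u + t n *\<^sub>R w) w u = F'' (x + s' n *\<^sub>R u + t' n *\<^sub>R w) u w"
    by metis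
  have x: "x \<in> S" using S[of 0 0] by simp
  have lim: "(\<lambda>n. F'' (x + p n *\<^sub>R u + q n *\<^sub>R w) a b) \<longlonglongrightarrow> F'' x a b"
    if p: "\<And>n. p n \<in> {0..h n}" and q: "\<And>n. q n \<in> {0..h n}" for p q a b
  proof -
    have "p \<longlonglongrightarrow> 0" "q \<longlonglongrightarrow> 0"
      using p q by (auto intro!: tendsto_sandwich[OF _ _ tendsto_const h0])
    then have "(\<lambda>n. x + p n *\<^sub>R u + q n *\<^sub>R w) \<longlonglongrightarrow> x + 0 *\<^sub>R u + 0 *\<^sub>R w"
      by (intro tendsto_intros)
    moreover have "x + p n *\<^sub>R u + q n *\<^sub>R w \<in> S" for n
      using p[of n] q[of n] h[of n] by (intro S) auto
    ultimately have "(\<lambda>n. F'' (x + p n *\<^sub>R u + q n *\<^sub>R w)) \<longlonglongrightarrow> F'' x"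
      using cont x by (intro continuous_on_tendsto_compose[OF cont]) auto
    then show ?thesis by (intro tendsto_intros)
  qed
  show ?thesis
    using LIMSEQ_unique[OF lim[OF st(1,2), of w u] lim[OF st(3,4), of u w, folded eq]] by simp
qed

lemma GDERIV_unique: "GDERIV f x :> g \<Longrightarrow> GDERIV f x :> g' \<Longrightarrow> g = g'"
  unfolding gderiv_def by (metis has_derivative_unique inner_commute vector_eq_rdot)

lemma grad_eq: "GDERIV f r :> g \<Longrightarrow> grad f r = g"
  unfolding grad_def by (blast intro: GDERIV_unique)

text \<open>The half-line accumulates at each of its points, also at \<open>0\<close>, so the
  derivative within it is unique and the choice in \<open>vector_derivative\<close> must return
  \<open>g'\<close>.\<close>

lemma time_deriv_eq:
  assumes "(g has_vector_derivative g') (at t within {0..})" "t \<ge> 0"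
  shows "time_deriv g t = g'"
proof -
  have "at t within {0..} \<noteq> bot"
  proof -
    have "at t within {t..t+1} \<noteq> bot" by (simp add: trivial_limit_within islimpt_Icc)
    moreover have "{t..t+1} \<subseteq> {0..}" using assms by auto
    ultimately show ?thesis by (metis at_le le_bot)
  qed
  moreover have "(g has_vector_derivative time_deriv g t) (at t within {0..})"
    unfolding time_deriv_def using assms(1)
    by (metis differentiableI_vector vector_derivative_works)
  ultimately show ?thesis using assms vector_derivative_unique_within by blast
qed

section \<open>Gradient, Hessian and time derivative read off the joint derivatives\<close>

locale C2_field =
  fixes D :: field2
  assumes C2: "C2_on (\<lambda>(t, r). D t r) ({0..} \<times> UNIV)"
begin

abbreviation (input) "half_space \<equiv> {0::real..} \<times> (UNIV :: (real^2) set)"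

text \<open>Ties the joint derivatives in time and space to the separately defined
  \<open>grad\<close>, \<open>hess\<close> and \<open>D_t\<close>. That \<open>grad (D t) r\<close>
  changes in time at the rate \<open>grad (D_t D t) r\<close> rests on the symmetry of mixed
  derivatives, also at \<open>t = 0\<close>.\<close>

lemma field_derivatives:
  shows has_derivative_D: "t \<ge> 0 \<Longrightarrow> ((\<lambda>(t, r). D t r) has_derivative
      (\<lambda>(\<tau>, h). \<tau> * D_t D t r + h \<bullet> grad (D t) r)) (at (t, r) within half_space)"
    and has_derivative_grad: "t \<ge> 0 \<Longrightarrow> ((\<lambda>(t, r). grad (D t) r) has_derivative
      (\<lambda>(\<tau>, h). \<tau> *\<^sub>R grad (D_t D t) r + hess (D t) r h)) (at (t, r) within half_space)"
    and continuous_on_grad_D_t: "continuous_on half_space (\<lambda>(t, r). grad (D_t D t) r)"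
    and continuous_on_hess: "continuous_on (half_space \<times> UNIV) (\<lambda>((t, r), h). hess (D t) r h)"
    and linear_hess: "t \<ge> 0 \<Longrightarrow> linear (hess (D t) r)"
proof -
  obtain F' :: "real \<times> (real^2) \<Rightarrow> (real \<times> (real^2)) \<Rightarrow>\<^sub>L real" and F''
    where F: "\<And>p. p \<in> half_space \<Longrightarrow> ((\<lambda>(t, r). D t r) has_derivative blinfun_apply (F' p)) (at p within half_space)"
      and F': "\<And>p. p \<in> half_space \<Longrightarrow> (F' has_derivative blinfun_apply (F'' p)) (at p within half_space)"
      and F''_cont: "continuous_on half_space F''"
    using C2 unfolding C2_on_def C1_on_def by blast
  \<comment> \<open>\<open>rep l\<close> is the Riesz vector of the spatial part of
    \<open>l\<close>. Being bounded linear, it carries differentiability and continuity over from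
    \<open>F'\<close> and \<open>F''\<close>.\<close>
  define rep :: "((real \<times> (real^2)) \<Rightarrow>\<^sub>L real) \<Rightarrow> real^2"
    where "rep l = (\<Sum>b\<in>Basis. l (0, b) *\<^sub>R b)" for l
  have rep_linear: "bounded_linear rep" unfolding rep_def
    by (intro bounded_linear_sum bounded_linear_compose[OF bounded_linear_scaleR_left] blinfun.bounded_linear_left)
  have inner_rep: "h \<bullet> rep l = l (0, h)" for h l
  proof -
    have "l (0, h) = l (0, \<Sum>b\<in>Basis. (h \<bullet> b) *\<^sub>R b)" by (simp add: euclidean_representation)
    also have "(0::real, \<Sum>b\<in>Basis. (h \<bullet> b) *\<^sub>R b) = (\<Sum>b\<in>Basis. (h \<bullet> b) *\<^sub>R (0, b))"
      by (simp add: prod_eq_iff fst_sum snd_sum)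
    also have "l \<dots> = (\<Sum>b\<in>Basis. (h \<bullet> b) * l (0, b))"
      by (simp only: blinfun.sum_right blinfun.scaleR_right real_scaleR_def)
    also have "\<dots> = h \<bullet> rep l"
      by (simp add: rep_def inner_sum_right mult.commute)
    finally show ?thesis by simp
  qed
  have split: "l (\<tau>, h) = \<tau> * l (1, 0) + h \<bullet> rep l" for l :: "(real \<times> (real^2)) \<Rightarrow>\<^sub>L real" and \<tau> h
  proof -
    have "(\<tau>, h) = \<tau> *\<^sub>R (1, 0) + (0, h)" by simp
    then show ?thesis unfolding inner_rep
      by (simp only: blinfun.add_right blinfun.scaleR_right) simp
  qed
  \<comment> \<open>Freezing time gives an unrestricted spatial derivative, as each slice is the
    whole plane; freezing the position, in \<open>tslice\<close>, gives one within the
    half-line.\<close>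
  have slice: "((\<lambda>r. G (t, r)) has_derivative (\<lambda>h. G' (0, h))) (at r)"
    if "(G has_derivative G') (at (t, r) within half_space)" "t \<ge> 0" for G G' t r
    by (rule has_derivative_in_compose[where f="\<lambda>r. (t, r)" and s=UNIV and g=G and f'="\<lambda>h. (0,h)"])
       (use that in \<open>auto intro!: derivative_eq_intros has_derivative_subset[OF that(1)]\<close>)
  have tslice: "((\<lambda>t. G (t, r)) has_derivative (\<lambda>\<tau>. G' (\<tau>, 0))) (at t within {0..})"
    if "(G has_derivative G') (at (t, r) within half_space)" "t \<ge> 0" for G G' t r
    by (rule has_derivative_in_compose[where f="\<lambda>t. (t, r)" and g=G and f'="\<lambda>\<tau>. (\<tau>, 0)"])
       (use that in \<open>auto intro!: derivative_eq_intros has_derivative_subset[OF that(1)]\<close>)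
  have grad: "grad (D t) r = rep (F' (t, r))" if "t \<ge> 0" for t r
    using slice[OF F[of "(t, r)"]] that by (intro grad_eq) (simp add: gderiv_def inner_rep)
  have D_t: "D_t D t r = F' (t, r) (1, 0)" if "t \<ge> 0" for t r
  proof -
    have "(\<lambda>\<tau>. F' (t, r) (\<tau>, 0)) = (\<lambda>\<tau>. \<tau> *\<^sub>R F' (t, r) (1, 0))"
      by (rule ext, subst split) simp
    with tslice[OF F[of "(t, r)"]] that show ?thesis
      unfolding D_t_def by (intro time_deriv_eq) (simp_all add: has_vector_derivative_def)
  qed
  have dgrad: "((\<lambda>(t, r). grad (D t) r) has_derivative (\<lambda>q. rep (F'' (t, r) q))) (at (t, r) within half_space)"
    if "t \<ge> 0" for t r
    by (rule has_derivative_transform[OF _ _ bounded_linear.has_derivative[OF rep_linear F']])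
       (use that in \<open>auto simp: grad\<close>)
  have hess: "hess (D t) r h = rep (F'' (t, r) (0, h))" if "t \<ge> 0" for t r h
    unfolding hess_def using frechet_derivative_at[OF slice[OF dgrad[OF that, of r] that]]
    by (simp add: fun_eq_iff)
  have grad_D_t: "grad (D_t D t) r = rep (F'' (t, r) (1, 0))" if t: "t \<ge> 0" for t r
  proof (rule grad_eq)
    have D_t_eq: "D_t D t = (\<lambda>r. F' (t, r) (1, 0))" using D_t[OF t] by auto
    have "((\<lambda>r. F' (t, r)) has_derivative (\<lambda>h. F'' (t, r) (0, h))) (at r)"
      using slice[OF F'[of "(t, r)"]] t by simp
    from bounded_linear.has_derivative[OF blinfun.bounded_linear_left this]
    have "((\<lambda>r. F' (t, r) (1, 0)) has_derivative (\<lambda>h. F'' (t, r) (0, h) (1, 0))) (at r)" .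
    \<comment> \<open>The parallelogram spanned by \<open>(0, h)\<close> and \<open>(1, 0)\<close>
      runs forward in time and thus stays in the half-space even from \<open>t = 0\<close>.\<close>
    moreover have "F'' (t, r) (0, h) (1, 0) = F'' (t, r) (1, 0) (0, h)" for h
      by (rule second_derivative_symmetric_within[OF F F' F''_cont]) (use t in auto)
    ultimately show "GDERIV (D_t D t) r :> rep (F'' (t, r) (1, 0))"
      by (simp add: gderiv_def inner_rep D_t_eq)
  qed
  have rep_lin: "linear rep" by (rule bounded_linear.linear[OF rep_linear])
  have F''_split: "rep (F'' p (\<tau>, h)) = \<tau> *\<^sub>R rep (F'' p (1, 0)) + rep (F'' p (0, h))" for p \<tau> h
  proof -
    have "(\<tau>, h) = \<tau> *\<^sub>R (1, 0) + (0, h)" by simp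
    then show ?thesis
      by (simp only: blinfun.add_right blinfun.scaleR_right linear_add[OF rep_lin]
          linear_scale[OF rep_lin])
  qed
  {
    assume t: "t \<ge> 0"
    show "((\<lambda>(t, r). D t r) has_derivative (\<lambda>(\<tau>, h). \<tau> * D_t D t r + h \<bullet> grad (D t) r))
        (at (t, r) within half_space)"
      using F[of "(t, r)"] t by (simp add: D_t grad split[symmetric])
    show "((\<lambda>(t, r). grad (D t) r) has_derivative
        (\<lambda>(\<tau>, h). \<tau> *\<^sub>R grad (D_t D t) r + hess (D t) r h)) (at (t, r) within half_space)"
      using dgrad[OF t] t by (simp add: grad_D_t hess F''_split[symmetric] cond_case_prod_eta)
    show "linear (hess (D t) r)"
      unfolding hess_def using slice[OF dgrad[OF t, of r] t] by (auto intro!: linear_frechet_derivative differentiableI)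
  next
    have "continuous_on half_space (\<lambda>p. rep (F'' p (1, 0)))"
      by (intro bounded_linear.continuous_on[OF rep_linear] continuous_intros F''_cont)
    then show "continuous_on half_space (\<lambda>(t, r). grad (D_t D t) r)"
      by (rule continuous_on_eq) (auto simp: grad_D_t)
    have "continuous_on (half_space \<times> UNIV) (\<lambda>(p, h). rep (F'' p (0, h)))"
      unfolding case_prod_beta
      by (intro bounded_linear.continuous_on[OF rep_linear] continuous_intros
          continuous_on_compose2[OF F''_cont]) auto
    then show "continuous_on (half_space \<times> UNIV) (\<lambda>((t, r), h). hess (D t) r h)"
      by (rule continuous_on_eq) (auto simp: hess)
  }
qed

end

section \<open>Headings and trajectories\<close>

lemma e_vec_eq: "e_vec \<theta> = cos \<theta> *\<^sub>R axis 1 1 + sin \<theta> *\<^sub>R axis 2 1"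
  by (simp add: e_vec_def vec_eq_iff forall_2 axis_def)

lemma norm_e_vec [simp]: "norm (e_vec \<theta>) = 1"
  by (simp add: e_vec_def norm_vec_def L2_set_def sum_2)

lemma e_vec_periodic: "e_vec (\<theta> + 2 * pi * of_int k) = e_vec \<theta>"
  by (simp add: e_vec_def cos_add sin_add)

text \<open>The derivative is the heading a quarter turn ahead, a unit vector.\<close>

lemma lipschitz_on_e_vec: "1-lipschitz_on UNIV e_vec"
proof (rule bounded_derivative_imp_lipschitz)
  fix x :: real
  show "(e_vec has_derivative (\<lambda>h. h *\<^sub>R (- sin x *\<^sub>R axis 1 1 + cos x *\<^sub>R axis 2 1))) (at x within UNIV)"
    unfolding e_vec_eq[abs_def] by (auto intro!: derivative_eq_intros simp: algebra_simps)
  have "- sin x *\<^sub>R axis 1 1 + cos x *\<^sub>R axis 2 1 = e_vec (x + pi/2)"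
    by (simp add: e_vec_eq cos_add sin_add)
  then show "onorm (\<lambda>h. h *\<^sub>R (- sin x *\<^sub>R axis 1 1 + cos x *\<^sub>R axis 2 1) :: real^2) \<le> 1"
    by (intro onorm_le) simp
qed auto

lemma rot_cw_scaleR: "rot_cw (c *\<^sub>R x) = c *\<^sub>R rot_cw x"
  by (simp add: rot_cw_def vec_eq_iff forall_2)

lemma norm_rot_cw [simp]: "norm (rot_cw x) = norm x"
  by (simp add: rot_cw_def norm_vec_def L2_set_def sum_2 add.commute)

text \<open>Each coordinate of the right-hand side is that of \<open>x\<close> times
  \<open>N$1 * N$1 + N$2 * N$2\<close>.\<close>

lemma orthonormal_frame_expansion:
  fixes N x :: "real^2"
  assumes "norm N = 1"
  shows "x = (x \<bullet> N) *\<^sub>R N + (x \<bullet> rot_cw N) *\<^sub>R rot_cw N"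
proof -
  have 1: "N$1 * N$1 + N$2 * N$2 = 1"
    using assms by (simp add: norm_eq_1 inner_vec_def sum_2)
  have "x$1 * (N$1 * N$1 + N$2 * N$2) = x$1" "x$2 * (N$1 * N$1 + N$2 * N$2) = x$2"
    unfolding 1 by simp_all
  then show ?thesis
    by (simp add: vec_eq_iff forall_2 rot_cw_def inner_vec_def sum_2 algebra_simps)
qed

text \<open>The plane is identified with the complex numbers. Angles count counterclockwise while
  \<open>rot_cw\<close> turns clockwise, hence the minus sign in the angular velocity.\<close>

lemma vec_polar_lift:
  fixes g g' :: "real \<Rightarrow> real^2"
  assumes deriv: "\<And>t. t \<in> {a..b} \<Longrightarrow> (g has_vector_derivative g' t) (at t within {a..b})"
    and cont: "continuous_on {a..b} g'"
    and nz: "\<And>t. t \<in> {a..b} \<Longrightarrow> g t \<noteq> 0"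
  obtains \<phi> where "\<And>t. t \<in> {a..b} \<Longrightarrow> g t = norm (g t) *\<^sub>R e_vec (\<phi> t)"
    "\<And>t. t \<in> {a..b} \<Longrightarrow>
      (\<phi> has_real_derivative - (g' t \<bullet> rot_cw (g t)) / (norm (g t))\<^sup>2) (at t within {a..b})"
proof -
  define C where "C x = of_real (x$1) + \<i> * of_real (x$2)" for x :: "real^2"
  have C: "bounded_linear C" unfolding C_def
    by (intro bounded_linear_add bounded_linear_const_mult
        bounded_linear_compose[OF bounded_linear_of_real] bounded_linear_vec_nth)
  have norm_C: "norm (C x) = norm x" for x
    by (simp add: C_def cmod_def norm_vec_def L2_set_def sum_2)
  obtain \<phi> where \<phi>: "\<And>t. t \<in> {a..b} \<Longrightarrow> C (g t) = norm (C (g t)) * cis (\<phi> t)"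
    "\<And>t. t \<in> {a..b} \<Longrightarrow> (\<phi> has_real_derivative Im (C (g' t) / C (g t))) (at t within {a..b})"
  proof (rule complex_polar_lift)
    show "((\<lambda>t. C (g t)) has_vector_derivative C (g' t)) (at t within {a..b})" if "t \<in> {a..b}" for t
      by (rule bounded_linear.has_vector_derivative[OF C deriv[OF that]])
    show "continuous_on {a..b} (\<lambda>t. C (g' t))" by (rule bounded_linear.continuous_on[OF C cont])
    show "C (g t) \<noteq> 0" if "t \<in> {a..b}" for t
      using nz[OF that] norm_C[of "g t"] by auto
  qed blast
  show ?thesis
  proof
    fix t assume t: "t \<in> {a..b}"
    from \<phi>(1)[OF t] show "g t = norm (g t) *\<^sub>R e_vec (\<phi> t)"
      unfolding norm_C by (simp add: C_def complex_eq_iff e_vec_def vec_eq_iff forall_2)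
    have "Im (C (g' t) / C (g t)) = - (g' t \<bullet> rot_cw (g t)) / (norm (g t))\<^sup>2"
      unfolding Im_divide
      by (simp add: C_def rot_cw_def inner_vec_def sum_2 norm_vec_def L2_set_def algebra_simps)
    with \<phi>(2)[OF t] show
      "(\<phi> has_real_derivative - (g' t \<bullet> rot_cw (g t)) / (norm (g t))\<^sup>2) (at t within {a..b})" by simp
  qed
qed

section \<open>The field along a curve and existence of closed-loop trajectories\<close>

context C2_field
begin

lemma continuous_on_D: "continuous_on half_space (\<lambda>(t, r). D t r)"
  unfolding continuous_on_eq_continuous_within
  by (auto intro: has_derivative_continuous[OF has_derivative_D])

lemma continuous_on_grad: "continuous_on half_space (\<lambda>(t, r). grad (D t) r)"
  unfolding continuous_on_eq_continuous_within
  by (auto intro: has_derivative_continuous[OF has_derivative_grad])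

lemma GDERIV_D:
  assumes "t \<ge> 0"
  shows "GDERIV (D t) r :> grad (D t) r"
proof -
  have "((\<lambda>r. case (t, r) of (t, r) \<Rightarrow> D t r) has_derivative
      (\<lambda>h. case (0, h) of (\<tau>, h) \<Rightarrow> \<tau> * D_t D t r + h \<bullet> grad (D t) r)) (at r)"
    by (rule has_derivative_in_compose[where s=UNIV and f="\<lambda>r. (t, r)" and f'="\<lambda>h. (0, h)"])
       (use assms in \<open>auto intro!: derivative_eq_intros has_derivative_subset[OF has_derivative_D[OF assms]]\<close>)
  then show ?thesis by (simp add: gderiv_def)
qed

lemma derivatives_along_curve:
  assumes x: "(x has_vector_derivative x') (at t within {0..})" and t: "t \<ge> 0"
  shows "((\<lambda>t. D t (x t)) has_real_derivative D_t D t (x t) + x' \<bullet> grad (D t) (x t)) (at t within {0..})"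
    and "((\<lambda>t. grad (D t) (x t)) has_vector_derivative
      grad (D_t D t) (x t) + hess (D t) (x t) x') (at t within {0..})"
proof -
  have pair: "((\<lambda>t. (t, x t)) has_derivative (\<lambda>\<tau>. (\<tau>, \<tau> *\<^sub>R x'))) (at t within {0..})"
    using x by (auto intro!: derivative_eq_intros simp: has_vector_derivative_def)
  have sub: "(\<lambda>t. (t, x t)) ` {0..} \<subseteq> half_space" by auto
  show "((\<lambda>t. D t (x t)) has_real_derivative D_t D t (x t) + x' \<bullet> grad (D t) (x t)) (at t within {0..})"
    using has_derivative_in_compose[OF pair has_derivative_subset[OF has_derivative_D[OF t] sub]]
    by (auto simp: has_field_derivative_def algebra_simps elim!: has_derivative_eq_rhs)
  show "((\<lambda>t. grad (D t) (x t)) has_vector_derivative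
      grad (D_t D t) (x t) + hess (D t) (x t) x') (at t within {0..})"
    using has_derivative_in_compose[OF pair has_derivative_subset[OF has_derivative_grad[OF t] sub]]
    by (simp add: has_vector_derivative_def linear_scale[OF linear_hess[OF t]] algebra_simps)
qed

text \<open>The speed is constant, so the right-hand side is bounded. On a bounded time range and a
  ball the gradient is bounded by compactness, so \<open>D t\<close>, and with it the heading, is
  Lipschitz in the position uniformly in time.\<close>

lemma closed_loop_exists: "\<exists>r. closed_loop D v \<nu> \<mu> ds r_in r"
proof -
  define f where "f t x = v *\<^sub>R e_vec (\<mu> * (D t x - \<nu> * t - ds))" for t x
  have e_cont: "continuous_on A e_vec" for A
    using lipschitz_on_continuous_on[OF lipschitz_on_e_vec] continuous_on_subset by blast
  obtain r where "r 0 = r_in" "\<And>t. t \<ge> 0 \<Longrightarrow> (r has_vector_derivative f t (r t)) (at t within {0..})"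
  proof (rule global_solution_exists[of f "\<bar>v\<bar>" r_in])
    show "continuous_on half_space (\<lambda>(t, x). f t x)"
      unfolding f_def case_prod_beta
      by (intro continuous_intros continuous_on_compose2[OF e_cont[of UNIV]]
          continuous_on_D[unfolded case_prod_beta]) auto
    show "norm (f t x) \<le> \<bar>v\<bar>" for t x by (simp add: f_def)
    fix T \<rho>
    have "compact ((\<lambda>(t, r). grad (D t) r) ` ({0..T} \<times> cball r_in \<rho>))"
      by (intro compact_continuous_image continuous_on_subset[OF continuous_on_grad] compact_Times) auto
    then obtain K where K: "K > 0" "\<And>t r. t \<in> {0..T} \<Longrightarrow> r \<in> cball r_in \<rho> \<Longrightarrow> norm (grad (D t) r) \<le> K"
      using compact_imp_bounded bounded_pos by (metis (mono_tags, lifting) case_prod_conv image_eqI mem_Sigma_iff)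
    have "(\<bar>v\<bar> * (1 * (\<bar>\<mu>\<bar> * K)))-lipschitz_on (cball r_in \<rho>) (f t)" if t: "t \<in> {0..T}" for t
    proof -
      have "K-lipschitz_on (cball r_in \<rho>) (D t)"
      proof (rule bounded_derivative_imp_lipschitz)
        fix x assume x: "x \<in> cball r_in \<rho>"
        show "(D t has_derivative (\<lambda>h. h \<bullet> grad (D t) x)) (at x within cball r_in \<rho>)"
          using GDERIV_D[of t x] t by (auto simp: gderiv_def intro: has_derivative_at_withinI)
        show "onorm (\<lambda>h. h \<bullet> grad (D t) x) \<le> K"
        proof (rule onorm_le)
          fix h
          have "norm (h \<bullet> grad (D t) x) \<le> norm h * norm (grad (D t) x)"
            by (simp add: Cauchy_Schwarz_ineq2)
          also have "\<dots> \<le> norm h * K" using K(2)[OF t x] by (intro mult_left_mono) auto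
          finally show "norm (h \<bullet> grad (D t) x) \<le> K * norm h" by (simp add: mult.commute)
        qed
      qed (use K in auto)
      then have "(\<bar>\<mu>\<bar> * K)-lipschitz_on (cball r_in \<rho>) (\<lambda>x. \<mu> * (D t x - \<nu> * t - ds))"
        by (auto simp: lipschitz_on_def dist_real_def abs_mult right_diff_distrib[symmetric]
            mult.assoc intro!: mult_left_mono)
      from lipschitz_on_compose2[OF this lipschitz_on_subset[OF lipschitz_on_e_vec]]
      show ?thesis unfolding f_def
        by (intro lipschitz_on_cmult) auto
    qed
    then show "\<exists>L. \<forall>t\<in>{0..T}. L-lipschitz_on (cball r_in \<rho>) (f t)" by blast
  qed blast
  then show ?thesis by (auto simp: closed_loop_def f_def)
qed

end

section \<open>Growth of the field value along the trajectory\<close>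

lemma C1_half_line_growth:
  fixes m :: "real \<Rightarrow> real"
  assumes C1: "C1_on m {0..}" and rate: "\<And>t. t \<ge> 0 \<Longrightarrow> \<bar>time_deriv m t\<bar> \<le> c"
    and "0 \<le> a" "a \<le> t"
  shows "m t - m a \<le> c * (t - a)"
proof (cases "a = t")
  case False
  obtain m' :: "real \<Rightarrow> real \<Rightarrow>\<^sub>L real"
    where "\<And>t. t \<ge> 0 \<Longrightarrow> (m has_derivative m' t) (at t within {0..})"
    using C1 unfolding C1_on_def by auto
  moreover have "blinfun_apply (m' t) = (\<lambda>h. h *\<^sub>R m' t 1)" for t
    by (rule ext) (metis blinfun.scaleR_right mult.right_neutral real_scaleR_def)
  ultimately have deriv: "(m has_vector_derivative m' t 1) (at t within {0..})" if "t \<ge> 0" for t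
    using that by (metis has_vector_derivative_def)
  have "(m has_derivative (\<lambda>h. h *\<^sub>R time_deriv m s)) (at s within {a..t})" if "s \<in> {a..t}" for s
    using time_deriv_eq[OF deriv, of s] deriv[of s] assms that
    by (auto simp: has_vector_derivative_def elim: has_derivative_subset)
  then obtain s where "s \<in> {a<..<t}" "m t - m a = (t - a) * time_deriv m s"
    using mvt_simple[of a t m "\<lambda>s h. h *\<^sub>R time_deriv m s"] False assms by auto
  moreover from this rate[of s] have "(t - a) * time_deriv m s \<le> (t - a) * c"
    using assms by (intro mult_left_mono) (auto simp: abs_le_iff)
  ultimately show ?thesis by (simp add: mult.commute)
qed simp

lemma C1_on_continuous: "C1_on f S \<Longrightarrow> continuous_on S f"
  unfolding C1_on_def by (auto intro: has_derivative_continuous_on)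

text \<open>The starting point is not among the fixed data, so parameters can be chosen before it is
  known.\<close>

locale regular_field = C2_field +
  fixes \<gamma>m \<gamma>s \<gamma>p :: "real \<Rightarrow> real" and V :: "real \<Rightarrow> (real^2) set"
    and v \<epsilon> \<gamma>bar b_omega_grad b_kappa b_tau :: real
  assumes v_pos: "v > 0"
    and gamma_smooth: "C1_on \<gamma>m {0..}" "C1_on \<gamma>s {0..}" "C1_on \<gamma>p {0..}"
    and gamma_order: "\<And>t. t \<ge> 0 \<Longrightarrow> \<gamma>m t < \<gamma>s t \<and> \<gamma>s t < \<gamma>p t"
    and V_level: "\<And>t r. t \<ge> 0 \<Longrightarrow> D t r \<ge> \<gamma>s t \<Longrightarrow> r \<in> V t"
    and bounds: "\<And>t r. (t, r) \<in> Z_reg D \<gamma>m \<gamma>p \<Longrightarrow> \<bar>iso_omega_grad D t r\<bar> \<le> b_omega_grad \<and>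
          \<bar>iso_kappa D t r\<bar> \<le> b_kappa \<and> \<bar>iso_tau_rho D t r\<bar> \<le> b_tau"
    and gamma_rate: "\<And>t. t \<ge> 0 \<Longrightarrow>
          \<bar>time_deriv \<gamma>m t\<bar> \<le> \<gamma>bar \<and> \<bar>time_deriv \<gamma>p t\<bar> \<le> \<gamma>bar \<and> \<bar>time_deriv \<gamma>s t\<bar> \<le> \<gamma>bar"
    and eps_pos: "\<epsilon> > 0"
    and rho_speed: "\<And>t r. (t, r) \<in> Z_reg D \<gamma>m \<gamma>p \<Longrightarrow>
          iso_rho D t r \<ge> \<epsilon> \<and>
          v \<ge> \<bar>iso_lambda D t r\<bar> + inverse (iso_rho D t r) * \<gamma>bar + \<epsilon>"
    and gamma_gap: "\<And>t. t \<ge> 0 \<Longrightarrow> \<gamma>m t + \<epsilon> \<le> \<gamma>s t \<and> \<gamma>s t \<le> \<gamma>p t - \<epsilon>"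
begin

lemma gamma_bar_nonneg: "\<gamma>bar \<ge> 0"
  using gamma_rate[of 0] by auto

lemma grad_nonzero: "(t, r) \<in> Z_reg D \<gamma>m \<gamma>p \<Longrightarrow> grad (D t) r \<noteq> 0"
  using rho_speed[of t r] eps_pos by (auto simp: iso_rho_def)

text \<open>The left-hand side is the rate of the field value for a robot heading along the
  gradient. Multiplying the speed condition by \<open>\<rho>\<close> clears its denominators, and
  \<open>\<rho> \<ge> \<epsilon>\<close> bounds the surplus \<open>\<epsilon> * \<rho>\<close> from
  below.\<close>

lemma uphill_rate:
  assumes "(t, r) \<in> Z_reg D \<gamma>m \<gamma>p"
  shows "D_t D t r + v * norm (grad (D t) r) \<ge> \<gamma>bar + \<epsilon>\<^sup>2"
proof -
  define \<rho> where "\<rho> = norm (grad (D t) r)"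
  have \<rho>: "\<rho> \<ge> \<epsilon>" "\<rho> > 0" "v \<ge> \<bar>D_t D t r / \<rho>\<bar> + \<gamma>bar / \<rho> + \<epsilon>"
    using rho_speed[OF assms] eps_pos by (auto simp: iso_rho_def iso_lambda_def \<rho>_def field_simps)
  have "v * \<rho> \<ge> (\<bar>D_t D t r / \<rho>\<bar> + \<gamma>bar / \<rho> + \<epsilon>) * \<rho>"
    using \<rho> by (intro mult_right_mono) auto
  also have "(\<bar>D_t D t r / \<rho>\<bar> + \<gamma>bar / \<rho> + \<epsilon>) * \<rho> = \<bar>D_t D t r\<bar> + \<gamma>bar + \<epsilon> * \<rho>"
    using \<rho> by (simp add: abs_divide field_simps)
  finally have "v * \<rho> \<ge> \<bar>D_t D t r\<bar> + \<gamma>bar + \<epsilon> * \<rho>" .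
  moreover have "\<epsilon> * \<rho> \<ge> \<epsilon>\<^sup>2"
    using \<rho> eps_pos by (simp add: power2_eq_square)
  ultimately show ?thesis unfolding \<rho>_def[symmetric] by linarith
qed

text \<open>The gradient turns because the field changes in time (\<open>b_omega_grad\<close>) and
  because the robot moves across and along isolines (\<open>b_tau\<close>, \<open>b_kappa\<close>).
  Absolute values keep the products monotone whatever the signs of the constants.\<close>

definition turn_bound :: real where
  "turn_bound = \<bar>b_omega_grad\<bar> + v * (\<bar>b_tau\<bar> + \<bar>b_kappa\<bar>)"

text \<open>Splitting the heading along \<open>N\<close> and \<open>T\<close> turns the Hessian term
  into \<open>iso_tau_rho\<close> and \<open>iso_kappa\<close> with coefficients of modulus at most
  one. The bound is thus free of \<open>\<theta>\<close>, hence of the gain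
  \<open>\<mu>\<close>.\<close>

lemma gradient_turning_rate:
  assumes Z: "(t, r) \<in> Z_reg D \<gamma>m \<gamma>p"
  shows "\<bar>((grad (D_t D t) r + hess (D t) r (v *\<^sub>R e_vec \<theta>)) \<bullet> rot_cw (grad (D t) r))
    / (norm (grad (D t) r))\<^sup>2\<bar> \<le> turn_bound"
proof -
  define g where "g = grad (D t) r"
  define H where "H = hess (D t) r"
  define N where "N = N_vec D t r"
  define T where "T = T_vec D t r"
  define e where "e = e_vec \<theta>"
  have g: "norm g > 0" using grad_nonzero[OF Z] by (simp add: g_def)
  have N_eq: "N = g /\<^sub>R norm g" and T_eq: "T = rot_cw N"
    by (simp_all add: N_def N_vec_def g_def T_def T_vec_def)
  have N1: "norm N = 1" using g by (simp add: N_eq)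
  have T1: "norm T = 1" by (simp add: T_eq N1)
  have rot: "rot_cw g = norm g *\<^sub>R T" using g by (simp add: T_eq N_eq rot_cw_scaleR)
  have "linear H" unfolding H_def using Z by (intro linear_hess) (simp add: Z_reg_def)
  note H = linear_add[OF this] linear_scale[OF this]
  have "H e = (e \<bullet> N) *\<^sub>R H N + (e \<bullet> T) *\<^sub>R H T"
    by (subst orthonormal_frame_expansion[OF N1, of e]) (simp only: H T_eq)
  then have "((grad (D_t D t) r + H (v *\<^sub>R e)) \<bullet> rot_cw g) / (norm g)\<^sup>2
      = (grad (D_t D t) r \<bullet> T) / norm g
        + v * ((e \<bullet> N) * ((H N \<bullet> T) / norm g) + (e \<bullet> T) * ((H T \<bullet> T) / norm g))"
    using g by (simp add: rot H inner_add_left field_simps power2_eq_square)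
  also have "\<dots> = - iso_omega_grad D t r + v * ((e \<bullet> N) * iso_tau_rho D t r - (e \<bullet> T) * iso_kappa D t r)"
    by (simp add: iso_omega_grad_def iso_tau_rho_def iso_kappa_def g_def H_def N_def T_def)
  also have "\<bar>\<dots>\<bar> \<le> \<bar>iso_omega_grad D t r\<bar> + \<bar>v * ((e \<bullet> N) * iso_tau_rho D t r - (e \<bullet> T) * iso_kappa D t r)\<bar>"
    by linarith
  also have "\<dots> \<le> turn_bound" unfolding turn_bound_def abs_mult[of v]
  proof (intro add_mono)
    have "\<bar>e \<bullet> N\<bar> \<le> 1" "\<bar>e \<bullet> T\<bar> \<le> 1"
      using Cauchy_Schwarz_ineq2[of e N] Cauchy_Schwarz_ineq2[of e T] N1 T1 by (simp_all add: e_def)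
    moreover have "\<bar>iso_tau_rho D t r\<bar> \<le> \<bar>b_tau\<bar>" "\<bar>iso_kappa D t r\<bar> \<le> \<bar>b_kappa\<bar>"
      using bounds[OF Z] by auto
    ultimately have "\<bar>(e \<bullet> N) * iso_tau_rho D t r\<bar> \<le> 1 * \<bar>b_tau\<bar>" "\<bar>(e \<bullet> T) * iso_kappa D t r\<bar> \<le> 1 * \<bar>b_kappa\<bar>"
      unfolding abs_mult by (intro mult_mono; simp)+
    then show "\<bar>v\<bar> * \<bar>(e \<bullet> N) * iso_tau_rho D t r - (e \<bullet> T) * iso_kappa D t r\<bar> \<le> v * (\<bar>b_tau\<bar> + \<bar>b_kappa\<bar>)"
      using v_pos by (auto intro!: mult_left_mono)
  qed (use bounds[OF Z] in auto)
  finally show ?thesis by (simp add: g_def H_def e_def)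
qed

text \<open>\<open>\<psi>\<close>, the angle from the gradient to the heading, starts between
  \<open>0\<close> and \<open>2 * pi\<close> and stays nonnegative. So \<open>\<theta>\<close> loses
  at most one turn plus the turning of the gradient, and division by \<open>\<mu>\<close> translates
  this into field values.\<close>

lemma field_growth_in_regular_zone:
  assumes loop: "closed_loop D v (\<gamma>bar + \<epsilon>\<^sup>2 / 2) \<mu> ds r_in r"
    and \<mu>: "\<mu> > 0" "\<mu> * (\<epsilon>\<^sup>2 / 4) \<ge> turn_bound"
    and a: "0 \<le> a" "a \<le> b"
    and Z: "\<And>t. t \<in> {a..b} \<Longrightarrow> (t, r t) \<in> Z_reg D \<gamma>m \<gamma>p"
  shows "D b (r b) - D a (r a) \<ge> (\<gamma>bar + \<epsilon>\<^sup>2 / 4) * (b - a) - 2 * pi / \<mu>"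
proof -
  \<comment> \<open>This slope is \<open>\<epsilon>\<^sup>2 / 2\<close> below the uphill rate, which
    drives the barrier, and \<open>\<epsilon>\<^sup>2 / 4\<close> above the claimed rate, which pays
    for the turning of the gradient.\<close>
  define \<nu> where "\<nu> = \<gamma>bar + \<epsilon>\<^sup>2 / 2"
  define \<theta> where "\<theta> t = \<mu> * (D t (r t) - \<nu> * t - ds)" for t
  define r' where "r' t = v *\<^sub>R e_vec (\<theta> t)" for t
  define d' where "d' t = D_t D t (r t) + r' t \<bullet> grad (D t) (r t)" for t
  define g where "g t = grad (D t) (r t)" for t
  define g' where "g' t = grad (D_t D t) (r t) + hess (D t) (r t) (r' t)" for t
  have sub: "{a..b} \<subseteq> {0..}" using a by auto
  have r': "(r has_vector_derivative r' t) (at t within {0..})" if "t \<in> {a..b}" for t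
    using loop sub that by (auto simp: closed_loop_def r'_def \<theta>_def \<nu>_def)
  have d': "((\<lambda>t. D t (r t)) has_real_derivative d' t) (at t within {a..b})"
    and g': "(g has_vector_derivative g' t) (at t within {a..b})" if "t \<in> {a..b}" for t
    using derivatives_along_curve[OF r'[OF that]] sub that unfolding d'_def g'_def g_def[abs_def]
    by (auto intro: DERIV_subset has_vector_derivative_within_subset)
  have r_cont: "continuous_on {a..b} r"
    by (rule continuous_on_vector_derivative) (rule has_vector_derivative_within_subset[OF r' sub])
  have pair_cont: "continuous_on {a..b} (\<lambda>t. (t, r t))"
    by (intro continuous_intros r_cont)
  have \<theta>': "(\<theta> has_real_derivative \<mu> * (d' t - \<nu>)) (at t within {a..b})" if "t \<in> {a..b}" for t
    unfolding \<theta>_def by (auto intro!: derivative_eq_intros d'[OF that])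
  have r'_cont: "continuous_on {a..b} r'"
    unfolding r'_def
    by (intro continuous_intros continuous_on_compose2[OF lipschitz_on_continuous_on[OF lipschitz_on_e_vec]]
        DERIV_continuous_on[OF \<theta>']) auto
  have g'_cont: "continuous_on {a..b} g'"
  proof -
    have "continuous_on {a..b} (\<lambda>t. grad (D_t D t) (r t))"
      using continuous_on_compose2[OF continuous_on_grad_D_t pair_cont] sub by force
    moreover have "continuous_on {a..b} (\<lambda>t. hess (D t) (r t) (r' t))"
      using continuous_on_compose2[OF continuous_on_hess continuous_on_Pair[OF pair_cont r'_cont]] sub
      by force
    ultimately show ?thesis unfolding g'_def by (intro continuous_intros)
  qed
  obtain \<phi> where \<phi>: "\<And>t. t \<in> {a..b} \<Longrightarrow> g t = norm (g t) *\<^sub>R e_vec (\<phi> t)"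
    "\<And>t. t \<in> {a..b} \<Longrightarrow>
      (\<phi> has_real_derivative - (g' t \<bullet> rot_cw (g t)) / (norm (g t))\<^sup>2) (at t within {a..b})"
    by (rule vec_polar_lift[OF g' g'_cont]) (use grad_nonzero[OF Z] in \<open>auto simp: g_def\<close>)
  define \<phi>' where "\<phi>' t = - (g' t \<bullet> rot_cw (g t)) / (norm (g t))\<^sup>2" for t
  note \<phi>' = \<phi>(2)[folded \<phi>'_def]
  have \<phi>'_le: "\<bar>\<phi>' t\<bar> \<le> turn_bound" if "t \<in> {a..b}" for t
    using gradient_turning_rate[OF Z[OF that], of "\<theta> t"] by (simp add: \<phi>'_def g'_def g_def r'_def)
  \<comment> \<open>The whole number of turns in the initial angle is removed, so that
    \<open>\<psi> a\<close> is within one turn above \<open>0\<close>.\<close>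
  define k where "k = \<lfloor>(\<theta> a - \<phi> a) / (2 * pi)\<rfloor>"
  define \<psi> where "\<psi> t = \<theta> t - \<phi> t - 2 * pi * of_int k" for t
  have "of_int k \<le> (\<theta> a - \<phi> a) / (2 * pi)" "(\<theta> a - \<phi> a) / (2 * pi) < of_int k + 1"
    unfolding k_def by linarith+
  then have \<psi>_init: "0 \<le> \<psi> a" "\<psi> a \<le> 2 * pi" unfolding \<psi>_def by (simp_all add: field_simps)
  \<comment> \<open>When \<open>\<psi> t = 0\<close> the heading is along the gradient, so
    \<open>\<theta>\<close> grows at least at rate \<open>\<mu> * (\<epsilon>\<^sup>2 / 2)\<close>,
    which exceeds \<open>turn_bound\<close> and hence the rate of \<open>\<phi>\<close>.\<close>
  have "\<psi> b \<ge> 0"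
  proof (rule nonneg_barrier[where \<psi>=\<psi> and t=b and \<psi>'="\<lambda>t. \<mu> * (d' t - \<nu>) - \<phi>' t"])
    show "(\<psi> has_real_derivative \<mu> * (d' t - \<nu>) - \<phi>' t) (at t within {a..b})" if "t \<in> {a..b}" for t
      unfolding \<psi>_def by (auto intro!: derivative_eq_intros \<theta>'[OF that] \<phi>'[OF that])
    fix t assume t: "t \<in> {a..b}" and "\<psi> t = 0"
    then have "\<theta> t = \<phi> t + 2 * pi * of_int k" by (simp add: \<psi>_def)
    then have "e_vec (\<theta> t) = e_vec (\<phi> t)" by (simp add: e_vec_periodic)
    then have "r' t \<bullet> g t = v * norm (g t)"
      by (subst \<phi>(1)[OF t]) (simp add: r'_def dot_square_norm)
    then have "d' t \<ge> \<gamma>bar + \<epsilon>\<^sup>2"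
      using uphill_rate[OF Z[OF t]] by (simp add: d'_def g_def)
    then have "\<mu> * (d' t - \<nu>) \<ge> \<mu> * (\<epsilon>\<^sup>2 / 2)" using \<mu> by (intro mult_left_mono) (auto simp: \<nu>_def)
    moreover have "\<mu> * (\<epsilon>\<^sup>2 / 2) > \<mu> * (\<epsilon>\<^sup>2 / 4)" using \<mu> eps_pos by simp
    ultimately show "\<mu> * (d' t - \<nu>) - \<phi>' t > 0" using \<phi>'_le[OF t] \<mu> by linarith
  qed (use \<psi>_init a in auto)
  moreover have "\<bar>\<phi> b - \<phi> a\<bar> \<le> turn_bound * (b - a)"
    using field_differentiable_bound[of "{a..b}" \<phi> \<phi>' turn_bound b a] \<phi>' \<phi>'_le a
    by (auto simp: abs_mult)
  ultimately have "\<theta> b - \<theta> a \<ge> - (2 * pi) - turn_bound * (b - a)"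
    using \<psi>_init by (simp add: \<psi>_def)
  moreover have "turn_bound * (b - a) \<le> \<mu> * (\<epsilon>\<^sup>2 / 4) * (b - a)" using \<mu> a by (intro mult_right_mono) auto
  moreover have "\<mu> * (D b (r b) - D a (r a)) = \<theta> b - \<theta> a + \<mu> * (\<nu> * (b - a))"
    by (simp add: \<theta>_def algebra_simps)
  moreover have "\<mu> * (\<nu> * (b - a)) = \<mu> * ((\<gamma>bar + \<epsilon>\<^sup>2 / 4) * (b - a)) + \<mu> * (\<epsilon>\<^sup>2 / 4) * (b - a)"
    by (simp add: \<nu>_def field_simps)
  ultimately have "\<mu> * (D b (r b) - D a (r a)) \<ge> \<mu> * ((\<gamma>bar + \<epsilon>\<^sup>2 / 4) * (b - a)) - 2 * pi"
    by linarith
  then show ?thesis using \<mu> by (simp add: field_simps)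
qed

text \<open>The level rises by at most \<open>\<gamma>bar * (b - a)\<close>, cancelling that term in
  the field growth. Used with \<open>\<gamma>m\<close> against dropping out of the zone, with
  \<open>\<gamma>p\<close> to force arrival, with \<open>\<gamma>s\<close> against falling
  back.\<close>

lemma level_gain_in_regular_zone:
  assumes "closed_loop D v (\<gamma>bar + \<epsilon>\<^sup>2 / 2) \<mu> ds r_in r" "\<mu> > 0" "\<mu> * (\<epsilon>\<^sup>2 / 4) \<ge> turn_bound"
    and a: "0 \<le> a" "a \<le> b"
    and "\<And>t. t \<in> {a..b} \<Longrightarrow> (t, r t) \<in> Z_reg D \<gamma>m \<gamma>p"
    and m: "m \<in> {\<gamma>m, \<gamma>s, \<gamma>p}"
  shows "D b (r b) - m b \<ge> D a (r a) - m a + \<epsilon>\<^sup>2 / 4 * (b - a) - 2 * pi / \<mu>"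
proof -
  have "m b - m a \<le> \<gamma>bar * (b - a)"
    using m gamma_smooth gamma_rate a by (intro C1_half_line_growth) auto
  with field_growth_in_regular_zone[OF assms(1-6)] show ?thesis by (simp add: algebra_simps)
qed

text \<open>The last two conditions on \<open>\<mu>\<close> make the loss of one turn smaller than
  the gap between \<open>\<gamma>s\<close> and \<open>\<gamma>p\<close> and smaller than the initial
  clearance above \<open>\<gamma>m\<close>.\<close>

lemma reaches_and_stays_if_high_gain:
  assumes \<mu>: "\<mu> > 0" "\<mu> * (\<epsilon>\<^sup>2 / 4) \<ge> turn_bound" "2 * pi / \<mu> < \<epsilon>" "2 * pi / \<mu> < D 0 r_in - \<gamma>m 0"
  shows "reaches_and_stays D v V (\<gamma>bar + \<epsilon>\<^sup>2 / 2) \<mu> ds r_in"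
  unfolding reaches_and_stays_def
proof (intro conjI allI impI closed_loop_exists)
  fix r assume loop: "closed_loop D v (\<gamma>bar + \<epsilon>\<^sup>2 / 2) \<mu> ds r_in r"
  define d where "d t = D t (r t)" for t
  have r_init: "r 0 = r_in" using loop by (simp add: closed_loop_def)
  have pi_pos: "2 * pi / \<mu> > 0" using \<mu> by simp
  have d_cont: "continuous_on {0..} d"
  proof -
    have "continuous_on {0..} r"
      using loop by (intro continuous_on_vector_derivative) (auto simp: closed_loop_def)
    from continuous_on_compose2[OF continuous_on_D continuous_on_Pair[OF continuous_on_id this]]
    show ?thesis by (simp add: d_def[abs_def] image_subset_iff)
  qed
  have cont: "continuous_on {a..b} (\<lambda>t. d t - m t)" if "m \<in> {\<gamma>m, \<gamma>s, \<gamma>p}" "a \<ge> 0" for a b m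
  proof -
    have "continuous_on {0..} m" using that gamma_smooth C1_on_continuous by auto
    with d_cont have "continuous_on {0..} (\<lambda>t. d t - m t)" by (intro continuous_intros)
    then show ?thesis by (rule continuous_on_subset) (use that in auto)
  qed
  have Z: "(t, r t) \<in> Z_reg D \<gamma>m \<gamma>p" if "t \<ge> 0" "\<gamma>m t \<le> d t" "d t \<le> \<gamma>p t" for t
    using that by (simp add: Z_reg_def d_def)
  note gain = level_gain_in_regular_zone[OF loop \<mu>(1,2), folded d_def]
  have "\<exists>t0\<ge>0. d t0 \<ge> \<gamma>p t0"
  proof (rule ccontr)
    assume "\<not> ?thesis"
    then have below: "d t < \<gamma>p t" if "t \<ge> 0" for t using that by force
    \<comment> \<open>Up to a first contact with \<open>\<gamma>m\<close> the robot is in the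
      regular zone, and contact would cost the whole initial clearance, more than one turn can
      take.\<close>
    have above: "d t > \<gamma>m t" if "t \<ge> 0" for t
    proof (rule ccontr)
      assume neg: "\<not> d t > \<gamma>m t"
      obtain c where c: "0 < c" "c \<le> t" "d c - \<gamma>m c = 0"
        and before: "\<And>s. 0 \<le> s \<Longrightarrow> s < c \<Longrightarrow> d s - \<gamma>m s > 0"
        by (rule first_zero_after_positive[OF cont[of \<gamma>m 0 t]])
           (use neg \<mu>(4) pi_pos r_init \<open>t \<ge> 0\<close> in \<open>auto simp: d_def\<close>)
      have "(s, r s) \<in> Z_reg D \<gamma>m \<gamma>p" if "s \<in> {0..c}" for s
        using that before[of s] c below[of s] by (cases "s = c") (auto intro!: Z)
      from gain[where a=0 and b=c and m=\<gamma>m, OF _ _ this] c have "d 0 - \<gamma>m 0 + \<epsilon>\<^sup>2 / 4 * c - 2 * pi / \<mu> \<le> 0" by simp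
      moreover have "\<epsilon>\<^sup>2 / 4 * c \<ge> 0" using c by simp
      ultimately show False using \<mu>(4) r_init by (simp add: d_def)
    qed
    \<comment> \<open>By this time the guaranteed gain makes up for the initial deficit to
      \<open>\<gamma>p\<close> and the loss of one turn.\<close>
    define T where "T = (\<gamma>p 0 - d 0 + 2 * pi / \<mu>) / (\<epsilon>\<^sup>2 / 4)"
    have T: "T \<ge> 0" using below[of 0] pi_pos by (simp add: T_def)
    have "(s, r s) \<in> Z_reg D \<gamma>m \<gamma>p" if "s \<in> {0..T}" for s
      using that below[of s] above[of s] by (intro Z) auto
    from gain[where a=0 and b=T and m=\<gamma>p, OF _ T this] have "d T - \<gamma>p T \<ge> d 0 - \<gamma>p 0 + \<epsilon>\<^sup>2 / 4 * T - 2 * pi / \<mu>" by simp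
    also have "\<epsilon>\<^sup>2 / 4 * T = \<gamma>p 0 - d 0 + 2 * pi / \<mu>" using eps_pos by (simp add: T_def)
    finally show False using below[OF T] by simp
  qed
  then obtain t0 where t0: "t0 \<ge> 0" "d t0 \<ge> \<gamma>p t0" by blast
  \<comment> \<open>A fall below \<open>\<gamma>s\<close> would leave \<open>\<gamma>p\<close> for
    the last time at some \<open>a\<close> and first meet \<open>\<gamma>s\<close> at some later
    \<open>c\<close>. In between the robot is in the regular zone and loses at least
    \<open>\<epsilon>\<close> relative to \<open>\<gamma>s\<close>.\<close>
  have "d b \<ge> \<gamma>s b" if b: "b \<ge> t0" for b
  proof (rule ccontr)
    assume neg: "\<not> d b \<ge> \<gamma>s b"
    obtain a where a: "t0 \<le> a" "a < b" "d a - \<gamma>p a = 0"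
      and after: "\<And>s. a < s \<Longrightarrow> s \<le> b \<Longrightarrow> d s - \<gamma>p s < 0"
      by (rule last_zero_before_negative[OF cont[of \<gamma>p t0 b]]) (use t0 b neg gamma_order[of b] in auto)
    have gap: "\<gamma>p a - \<gamma>s a \<ge> \<epsilon>" using gamma_gap[of a] t0 a by auto
    obtain c where c: "a < c" "c \<le> b" "d c - \<gamma>s c = 0"
      and before: "\<And>s. a \<le> s \<Longrightarrow> s < c \<Longrightarrow> d s - \<gamma>s s > 0"
      by (rule first_zero_after_positive[OF cont[of \<gamma>s a b]]) (use a t0 gap eps_pos neg in auto)
    have "(s, r s) \<in> Z_reg D \<gamma>m \<gamma>p" if "s \<in> {a..c}" for s
    proof (rule Z)
      show "s \<ge> 0" using that a t0 by auto
      then show "\<gamma>m s \<le> d s"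
        using that before[of s] c gamma_order[of s] by (cases "s = c") auto
      show "d s \<le> \<gamma>p s" using that after[of s] a c by (cases "s = a") auto
    qed
    from gain[where a=a and b=c and m=\<gamma>s, OF _ _ this] a c t0
    have "d a - \<gamma>s a + \<epsilon>\<^sup>2 / 4 * (c - a) - 2 * pi / \<mu> \<le> 0" by simp
    moreover have "\<epsilon>\<^sup>2 / 4 * (c - a) \<ge> 0" using c by simp
    ultimately show False using gap a(3) \<mu>(3) by linarith
  qed
  then show "\<exists>t0\<ge>0. \<forall>t\<ge>t0. r t \<in> V t"
    using t0 V_level unfolding d_def by (meson order_trans)
qed

text \<open>The starting point enters the gain conditions only through its clearance above
  \<open>\<gamma>m 0\<close>, so one choice serves all points with clearance at least
  \<open>\<delta>\<close>.\<close>

lemma uniform_parameters: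
  assumes "\<delta> > 0"
  obtains \<nu> \<mu> ds where "\<nu> > 0" "\<mu> > 0"
    "\<And>r_in. D 0 r_in \<ge> \<gamma>m 0 + \<delta> \<Longrightarrow> reaches_and_stays D v V \<nu> \<mu> ds r_in"
proof -
  define \<eta> where "\<eta> = min \<epsilon> \<delta>"
  have \<eta>: "\<eta> > 0" "\<eta> \<le> \<epsilon>" "\<eta> \<le> \<delta>" using assms eps_pos by (auto simp: \<eta>_def)
  \<comment> \<open>The first entry dominates the turning of the gradient; the second makes
    \<open>2 * pi / \<mu>\<close> at most \<open>\<eta> / 2\<close>, hence strictly below
    \<open>\<epsilon>\<close> and \<open>\<delta>\<close>.\<close>
  define \<mu> where "\<mu> = max (turn_bound / (\<epsilon>\<^sup>2 / 4)) (4 * pi / \<eta>)"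
  have "4 * pi / \<eta> \<le> \<mu>" "turn_bound / (\<epsilon>\<^sup>2 / 4) \<le> \<mu>" by (auto simp: \<mu>_def)
  moreover have "4 * pi / \<eta> > 0" using \<eta> by simp
  ultimately have "\<mu> > 0" by linarith
  with \<open>4 * pi / \<eta> \<le> \<mu>\<close> \<open>turn_bound / (\<epsilon>\<^sup>2 / 4) \<le> \<mu>\<close> have \<mu>: "\<mu> > 0" "turn_bound \<le> \<mu> * (\<epsilon>\<^sup>2 / 4)" "4 * pi \<le> \<mu> * \<eta>"
    using \<eta> eps_pos by (auto simp: pos_divide_le_eq)
  have "2 * pi < \<mu> * \<eta>" using \<mu> pi_gt_zero by linarith
  then have "2 * pi / \<mu> < \<eta>" using \<mu> by (simp add: pos_divide_less_eq mult.commute)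
  then show ?thesis
    using \<eta> \<mu> gamma_bar_nonneg eps_pos
    by (intro that[of "\<gamma>bar + \<epsilon>\<^sup>2 / 2" \<mu> 0] reaches_and_stays_if_high_gain) (auto intro: add_nonneg_pos)
qed

end

section \<open>From the initial clearance to the parameters\<close>

theorem theorem4p1:
  fixes D :: "real \<Rightarrow> real^2 \<Rightarrow> real"
    and r0 :: "real \<Rightarrow> real^2"
    and \<gamma>inf \<gamma>m \<gamma>s \<gamma>p :: "real \<Rightarrow> real"
    and V :: "real \<Rightarrow> (real^2) set"
    and r_in :: "real^2"
    and v R \<epsilon> \<gamma>p0 \<gamma>bar :: real
    and b_rho b_lambda b_omega b_omega_grad b_kappa b_v b_alpha b_tau b_n :: real
  assumes v_pos: "v > 0"
    (* (A1) *)
    and D_C2: "C2_on (\<lambda>(t, r). D t r) ({0..} \<times> UNIV)"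
    and r0_cont: "continuous_on {0..} r0"
    and ginf_cont: "continuous_on {0..} \<gamma>inf"
    and ginf_less: "\<And>t. t \<ge> 0 \<Longrightarrow> \<gamma>inf t < D t (r0 t)"
    and grad_nz: "\<And>t r. t \<ge> 0 \<Longrightarrow> r \<noteq> r0 t \<Longrightarrow> grad (D t) r \<noteq> 0"
    and D_lim: "\<And>t. t \<ge> 0 \<Longrightarrow> (D t \<longlongrightarrow> \<gamma>inf t) at_infinity"
    (* (A2) *)
    and R_pos: "R > 0"
    and V_def: "\<And>t. t \<ge> 0 \<Longrightarrow> V t = ball (r0 t) R"
    and gamma_smooth: "C1_on \<gamma>m {0..}" "C1_on \<gamma>s {0..}" "C1_on \<gamma>p {0..}"
    and gamma_order: "\<And>t. t \<ge> 0 \<Longrightarrow>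
          \<gamma>inf t < \<gamma>m t \<and> \<gamma>m t < \<gamma>s t \<and> \<gamma>s t < \<gamma>p t \<and> \<gamma>p t < D t (r0 t)"
    and init: "\<gamma>m 0 < D 0 r_in"
    and V_level: "\<And>t r. t \<ge> 0 \<Longrightarrow> D t r \<ge> \<gamma>s t \<Longrightarrow> r \<in> V t"
    (* (A3) *)
    and bounds: "\<And>t r. (t, r) \<in> Z_reg D \<gamma>m \<gamma>p \<Longrightarrow>
          \<bar>iso_rho D t r\<bar> \<le> b_rho \<and> \<bar>iso_lambda D t r\<bar> \<le> b_lambda \<and>
          \<bar>iso_omega D t r\<bar> \<le> b_omega \<and> \<bar>iso_omega_grad D t r\<bar> \<le> b_omega_grad \<and>
          \<bar>iso_kappa D t r\<bar> \<le> b_kappa \<and> \<bar>iso_v_rho D t r\<bar> \<le> b_v \<and>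
          \<bar>iso_alpha D t r\<bar> \<le> b_alpha \<and> \<bar>iso_tau_rho D t r\<bar> \<le> b_tau \<and>
          \<bar>iso_n_rho D t r\<bar> \<le> b_n"
    and gp_bound: "\<And>t. t \<ge> 0 \<Longrightarrow> \<gamma>p t \<le> \<gamma>p0"
    and gamma_rate: "\<And>t. t \<ge> 0 \<Longrightarrow>
          \<bar>time_deriv \<gamma>m t\<bar> \<le> \<gamma>bar \<and> \<bar>time_deriv \<gamma>p t\<bar> \<le> \<gamma>bar \<and> \<bar>time_deriv \<gamma>s t\<bar> \<le> \<gamma>bar"
    (* (A4) *)
    and eps_pos: "\<epsilon> > 0"
    and rho_speed: "\<And>t r. (t, r) \<in> Z_reg D \<gamma>m \<gamma>p \<Longrightarrow>
          iso_rho D t r \<ge> \<epsilon> \<and>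
          v \<ge> \<bar>iso_lambda D t r\<bar> + inverse (iso_rho D t r) * \<gamma>bar + \<epsilon>"
    and gamma_gap: "\<And>t. t \<ge> 0 \<Longrightarrow> \<gamma>m t + \<epsilon> \<le> \<gamma>s t \<and> \<gamma>s t \<le> \<gamma>p t - \<epsilon>"
  shows "(\<exists>\<nu> \<mu> ds. \<nu> > 0 \<and> \<mu> > 0 \<and> reaches_and_stays D v V \<nu> \<mu> ds r_in) \<and>
         (\<forall>E. bounded E \<and> closed E \<and> E \<subseteq> interior {r. (0, r) \<in> Z_reg D \<gamma>m \<gamma>p} \<longrightarrow>
            (\<exists>\<nu> \<mu> ds. \<nu> > 0 \<and> \<mu> > 0 \<and> (\<forall>r_in'\<in>E. reaches_and_stays D v V \<nu> \<mu> ds r_in')))"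
proof -
  interpret regular_field D \<gamma>m \<gamma>s \<gamma>p V v \<epsilon> \<gamma>bar b_omega_grad b_kappa b_tau
  proof
    show "C2_on (\<lambda>(t, r). D t r) ({0..} \<times> UNIV)" by (rule D_C2)
    show "r \<in> V t" if "t \<ge> 0" "D t r \<ge> \<gamma>s t" for t r by (rule V_level[OF that])
  qed (use v_pos gamma_smooth gamma_order bounds gamma_rate eps_pos rho_speed gamma_gap in auto)
  show ?thesis
  proof (intro conjI allI impI)
    obtain \<nu> \<mu> ds where "\<nu> > 0" "\<mu> > 0" "reaches_and_stays D v V \<nu> \<mu> ds r_in"
      by (rule uniform_parameters[of "D 0 r_in - \<gamma>m 0"]) (use init in auto)
    then show "\<exists>\<nu> \<mu> ds. \<nu> > 0 \<and> \<mu> > 0 \<and> reaches_and_stays D v V \<nu> \<mu> ds r_in" by blast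
    fix E :: "(real^2) set"
    assume E: "bounded E \<and> closed E \<and> E \<subseteq> interior {r. (0, r) \<in> Z_reg D \<gamma>m \<gamma>p}"
    \<comment> \<open>An interior point with \<open>D 0 r\<close> at the lower level would minimise
      \<open>D 0\<close> over \<open>U\<close>, so its gradient would vanish, against
      \<open>grad_nonzero\<close>.\<close>
    have above: "\<gamma>m 0 < D 0 r" if r: "r \<in> E" for r
    proof (rule ccontr)
      define U where "U = interior {r. (0, r) \<in> Z_reg D \<gamma>m \<gamma>p}"
      have U: "open U" "r \<in> U" "\<And>y. y \<in> U \<Longrightarrow> (0, y) \<in> Z_reg D \<gamma>m \<gamma>p"
        using E r interior_subset by (auto simp: U_def)
      assume "\<not> \<gamma>m 0 < D 0 r"
      then have "D 0 r \<le> D 0 y" if "y \<in> U" for y using U(3)[OF that] by (auto simp: Z_reg_def)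
      then have "(\<lambda>h. h \<bullet> grad (D 0) r) = (\<lambda>h. 0)"
        using GDERIV_D[of 0 r] U(1,2) by (intro differential_zero_maxmin[of r U "D 0"]) (auto simp: gderiv_def)
      then have "grad (D 0) r \<bullet> grad (D 0) r = 0" by (rule fun_cong)
      then show False using grad_nonzero[OF U(3)[OF U(2)]] by simp
    qed
    \<comment> \<open>Compactness of \<open>E\<close> makes the clearance attain a positive minimum;
      for empty \<open>E\<close> any positive number does.\<close>
    obtain \<delta> where \<delta>: "\<delta> > 0" "\<And>r. r \<in> E \<Longrightarrow> D 0 r \<ge> \<gamma>m 0 + \<delta>"
    proof (cases "E = {}")
      case False
      have "continuous_on E (D 0)"
        using GDERIV_D[of 0] unfolding gderiv_def
        by (intro continuous_at_imp_continuous_on ballI) (auto intro: has_derivative_continuous)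
      moreover have "compact E" using E by (simp add: compact_eq_bounded_closed)
      ultimately obtain x where "x \<in> E" "\<And>r. r \<in> E \<Longrightarrow> D 0 x \<le> D 0 r"
        using continuous_attains_inf[of E "D 0"] False by blast
      then show ?thesis using above[of x] by (intro that[of "D 0 x - \<gamma>m 0"]) auto
    qed (auto intro: that[of 1])
    obtain \<nu> \<mu> ds where "\<nu> > 0" "\<mu> > 0"
      "\<And>r. D 0 r \<ge> \<gamma>m 0 + \<delta> \<Longrightarrow> reaches_and_stays D v V \<nu> \<mu> ds r"
      by (rule uniform_parameters[OF \<delta>(1)]) blast
    with \<delta>(2) show "\<exists>\<nu> \<mu> ds. \<nu> > 0 \<and> \<mu> > 0 \<and> (\<forall>r_in'\<in>E. reaches_and_stays D v V \<nu> \<mu> ds r_in')"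
      by blast
  qed
qed

end
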